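(* There exist absolute positive constants $c_0,C_0,C_1$ which have property (P) (stated in the context) and such that the following holds. Let $\mathbf v_1,\dots,\mathbf v_M\in\mathbb{C}^N$ be a system of vectors such that $$\sum_{j=1}^M|\langle\mathbf w,\mathbf v_j\rangle|^2=\|\mathbf w\|_2^2\qquad\text{for all }\mathbf w\in\mathbb{C}^N .$$ Then there exists a set of weights $\lambda_j\ge0$, $j=1,\dots,M$, such that $|\{j:\lambda_j\ne0\}|\le 2C_1N$ and for all $\mathbf w\in\mathbb{C}^N$ $$c_0\|\mathbf w\|_2^2\le\sum_{j=1}^M\lambda_j|\langle\mathbf w,\mathbf v_j\rangle|^2\le C_0\|\mathbf w\|_2^2 .$$
   Context: $\langle\cdot,\cdot\rangle$ and $\|\cdot\|_2$ are the standard inner product and Euclidean norm on $\mathbb{C}^N$, $N\ge1$. "Absolute" means that the constants do not depend on $M,N$ or the vectors. Property (P) of constants $c_0,C_0,C_1>0$: for all $M,N\ge 1$, all vectors $\mathbf v_1,\dots,\mathbf v_M\in\mathbb{C}^N$ with $\sum_{j=1}^M|\langle\mathbf w,\mathbf v_j\rangle|^2=\|\mathbf w\|_2^2$ for all $\mathbf w\in\mathbb{C}^N$, and all real $\theta\le M/N$ with $\|\mathbf v_j\|_2^2\le\theta N/M$ for $j=1,\dots,M$, there is a subset $J\subset\{1,\dots,M\}$ with $|J|\le C_1\theta N$ such that $c_0\theta\|\mathbf w\|_2^2\le\frac MN\sum_{j\in J}|\langle\mathbf w,\mathbf v_j\rangle|^2\le C_0\theta\|\mathbf w\|_2^2$ for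 all $\mathbf w\in\mathbb{C}^N$. *)

theory Defs
  imports Complex_Main "Jordan_Normal_Form.Matrix" "Jordan_Normal_Form.Conjugate"
begin

text \<open>
  The dimension \<open>N\<close> is quantified inside the scope of the absolute constants, so \<open>\<complex>\<^sup>N\<close> is the
  carrier \<open>carrier_vec N\<close> of complex vectors of length \<open>N\<close> rather than a type indexed by its
  dimension. The standard inner product \<open>\<langle>x, y\<rangle>\<close> is \<open>x \<bullet>c y\<close>, which is linear in \<open>x\<close> and
  conjugate linear in \<open>y\<close>. Systems \<open>v\<^sub>1, \<dots>, v\<^sub>M\<close> are functions on \<open>nat\<close> of which only the values
  on \<open>{1..M}\<close> matter.
\<close>

definition cvec_norm :: "complex vec \<Rightarrow> real" where
  "cvec_norm w = sqrt (\<Sum>i<dim_vec w. (cmod (w $ i))\<^sup>2)"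

definition parseval_system :: "nat \<Rightarrow> nat \<Rightarrow> (nat \<Rightarrow> complex vec) \<Rightarrow> bool" where
  "parseval_system M N v \<longleftrightarrow>
     (\<forall>j\<in>{1..M}. v j \<in> carrier_vec N) \<and>
     (\<forall>w\<in>carrier_vec N. (\<Sum>j=1..M. (cmod (w \<bullet>c v j))\<^sup>2) = (cvec_norm w)\<^sup>2)"

definition property_P :: "real \<Rightarrow> real \<Rightarrow> real \<Rightarrow> bool" where
  "property_P c0 C0 C1 \<longleftrightarrow>
     (\<forall>M\<ge>1. \<forall>N\<ge>1. \<forall>v. \<forall>\<theta>::real.
        parseval_system M N v \<longrightarrow>
        \<theta> \<le> real M / real N \<longrightarrow>
        (\<forall>j\<in>{1..M}. (cvec_norm (v j))\<^sup>2 \<le> \<theta> * real N / real M) \<longrightarrow>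
        (\<exists>J\<subseteq>{1..M}. real (card J) \<le> C1 * \<theta> * real N \<and>
           (\<forall>w\<in>carrier_vec N.
              c0 * \<theta> * (cvec_norm w)\<^sup>2 \<le> real M / real N * (\<Sum>j\<in>J. (cmod (w \<bullet>c v j))\<^sup>2) \<and>
              real M / real N * (\<Sum>j\<in>J. (cmod (w \<bullet>c v j))\<^sup>2) \<le> C0 * \<theta> * (cvec_norm w)\<^sup>2)))"

end

theory Submission
  imports "HOL-Analysis.Complex_Analysis_Basics" Defs "Jordan_Normal_Form.Determinant"
begin

text \<open>
  The core is Weaver's two-block theorem of Marcus, Spielman and Srivastava, relative to a frame
  operator \<open>B = \<Sum>\<^sub>i v\<^sub>i v\<^sub>i\<^sup>*\<close>: if \<open>|\<langle>w, v\<^sub>i\<rangle>|\<^sup>2 \<le> \<epsilon> \<langle>B w, w\<rangle>\<close> for all \<open>w\<close>, the indices split into \<open>S\<close> and its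
  complement so that both partial frame operators are at most \<open>\<beta>/2 B\<close>, where \<open>\<beta> = (1 + \<surd>(2\<epsilon>))\<^sup>2\<close>.

  Let \<open>q(z) = det (\<Sum>\<^sub>i z\<^sub>i v\<^sub>i v\<^sub>i\<^sup>*)\<close>, which is real stable and affine in each variable. Averaging
  \<open>q(x 1 - 2 1\<^sub>S) q(x 1 - 2 1\<^sub>S\<^sub>')\<close> over all pairs of a set \<open>S\<close> and its complement \<open>S'\<close> amounts to
  applying all the operators \<open>1 - \<partial>\<^sub>i\<close> to \<open>q\<^sup>2\<close> on the diagonal. A barrier argument shows that the
  average is positive for \<open>x \<ge> \<beta>\<close>. Deciding the membership of one index after the other preserves
  positivity on \<open>[\<beta>, \<infinity>)\<close> for one of the two branches, because the relevant quotients \<open>Q/P\<close> have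
  nonpositive imaginary part in the upper half plane and hence decrease on the real line. Both factors
  of the final product are therefore nonzero on \<open>[\<beta>, \<infinity>)\<close>, which is the claimed bound.

  The upper bound for the complement is a lower bound for \<open>S\<close>. Halving repeatedly and keeping the
  smaller part each time, until the lower frame bound is comparable to the largest \<open>\<parallel>v\<^sub>j\<parallel>\<^sup>2\<close>, gives
  property (P); the losses form a geometric series. Weights are obtained by splitting the
  vectors into many short copies.
\<close>

section \<open>Quotients of real quadratic polynomials\<close>

text \<open>With P = c + b z + a z^2 and Q = f + e z + d z^2, the imaginary part in the hypothesis
  at z = u + iv is v (g v^2 + w), where w is the Wronskian Q' P - Q P' at u. Dividing by v and
  letting v tend to 0 leaves w.\<close>

lemma tangent_form_nonpos:
  fixes a b c d e f u :: real
  assumes "\<And>u v. v > 0 \<Longrightarrow> Im ((of_real f + of_real e * Complex u v + of_real d * (Complex u v)\<^sup>2) *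
      cnj (of_real c + of_real b * Complex u v + of_real a * (Complex u v)\<^sup>2)) \<le> 0"
  shows "(d * b - e * a) * u\<^sup>2 + 2 * (d * c - f * a) * u + (e * c - f * b) \<le> 0"
proof (rule ccontr)
  define g where "g = d * b - e * a"
  define w where "w = g * u\<^sup>2 + 2 * (d * c - f * a) * u + (e * c - f * b)"
  assume "\<not> ?thesis"
  then have w: "w > 0" by (simp add: w_def g_def)
  have key: "g * v\<^sup>2 + w \<le> 0" if "v > 0" for v
  proof -
    have "v * (g * v\<^sup>2 + w) \<le> 0"
      using assms[of v u] that
      by (simp add: w_def g_def power2_eq_square algebra_simps)
    then show ?thesis using that by (simp add: mult_le_0_iff)
  qed
  \<comment> \<open>Small enough that g v^2 cannot outweigh w; the added 1 covers g = 0.\<close>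
  define v where "v = sqrt (w / (2 * (\<bar>g\<bar> + 1)))"
  have v: "v > 0" using w by (simp add: v_def)
  have v2: "v\<^sup>2 = w / (2 * (\<bar>g\<bar> + 1))" using w by (simp add: v_def)
  have "\<bar>g\<bar> * v\<^sup>2 \<le> w / 2"
    unfolding v2 using w by (simp add: field_simps)
  moreover have "g * v\<^sup>2 \<ge> - (\<bar>g\<bar> * v\<^sup>2)"
    using mult_right_mono[of "- \<bar>g\<bar>" g "v\<^sup>2"] by simp
  ultimately show False using key[OF v] w by linarith
qed

text \<open>For P = c + b u + a u^2 and Q = f + e u + d u^2, \<open>W\<close> says Q' P - Q P' \<le>
  0 on the real line, and \<open>V\<close> says P'' P \<le> P'^2, the same inequality with P' in
  place of Q.\<close>

locale quadratic_ratio =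
  fixes a b c d e f :: real
  assumes W: "\<And>u. (d * b - e * a) * u\<^sup>2 + 2 * (d * c - f * a) * u + (e * c - f * b) \<le> 0"
  and V: "\<And>u. 2 * a * (c + b * u + a * u\<^sup>2) \<le> (b + 2 * a * u)\<^sup>2"
  and pos: "\<And>u. u \<ge> 0 \<Longrightarrow> c + b * u + a * u\<^sup>2 > 0"
begin

text \<open>These are the coefficients in Q P' - Q' P = \<gamma> u^2 + 2 \<beta> u + \<alpha>; up to
  sign, they are the 2 x 2 minors of the coefficient rows of P and Q.\<close>

definition "\<alpha> = f * b - e * c"
definition "\<beta> = f * a - d * c"
definition "\<gamma> = e * a - d * b"

lemma c_pos: "c > 0" using pos[of 0] by simp

lemma a_nonneg: "a \<ge> 0"
proof (rule ccontr)
  assume "\<not> ?thesis"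
  then have a: "a < 0" by simp
  define u where "u = (\<bar>b\<bar> + c + 1) / (- a) + 1"
  have u1: "u \<ge> 1" using a c_pos by (simp add: u_def divide_nonneg_nonpos)
  have "- a * u \<ge> \<bar>b\<bar> + c + 1" using a by (simp add: u_def field_simps)
  then have "(- a * u) * u \<ge> (\<bar>b\<bar> + c + 1) * u" using u1 by (intro mult_right_mono) auto
  moreover have "b * u \<le> \<bar>b\<bar> * u" using u1 by (intro mult_right_mono) auto
  moreover have "c \<le> c * u" using u1 c_pos by simp
  moreover have "(- a * u) * u = - (a * u\<^sup>2)" "(\<bar>b\<bar> + c + 1) * u = \<bar>b\<bar> * u + c * u + u"
    by (simp_all add: power2_eq_square distrib_right)
  ultimately have "c + b * u + a * u\<^sup>2 \<le> 0" using u1 by linarith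
  then show False using pos[of u] u1 by linarith
qed

lemma b_nonneg: "b \<ge> 0"
proof (rule ccontr)
  assume "\<not> ?thesis"
  then have b: "b < 0" by simp
  show False
  proof (cases "a = 0")
    case True
    then show ?thesis using pos[of "c / (- b)"] b c_pos by (simp add: field_simps)
  next
    case False
    then have a: "a > 0" using a_nonneg by simp
    \<comment> \<open>The critical point of P, where \<open>V\<close> reads 2 a P \<le> 0.\<close>
    define u where "u = - b / (2 * a)"
    have u: "u > 0" using a b by (simp add: u_def divide_neg_pos)
    have "b + 2 * a * u = 0" using a by (simp add: u_def)
    then have "2 * a * (c + b * u + a * u\<^sup>2) \<le> 0" using V[of u] by simp
    then show ?thesis using pos[of u] u a by (simp add: mult_le_0_iff)
  qed
qed

lemma \<alpha>_nonneg: "\<alpha> \<ge> 0" using W[of 0] by (simp add: \<alpha>_def)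

lemma form: "\<gamma> * u\<^sup>2 + 2 * \<beta> * u + \<alpha> \<ge> 0"
  using W[of u] by (simp add: \<alpha>_def \<beta>_def \<gamma>_def algebra_simps)

lemma \<gamma>_nonneg: "\<gamma> \<ge> 0"
proof (rule ccontr)
  assume "\<not> ?thesis"
  then have g: "\<gamma> < 0" by simp
  define u where "u = (2 * \<bar>\<beta>\<bar> + \<alpha> + 1) / (- \<gamma>) + 1"
  have u1: "u \<ge> 1" using g \<alpha>_nonneg by (simp add: u_def divide_nonneg_nonpos)
  have "- \<gamma> * u \<ge> 2 * \<bar>\<beta>\<bar> + \<alpha> + 1" using g by (simp add: u_def field_simps)
  then have "(- \<gamma> * u) * u \<ge> (2 * \<bar>\<beta>\<bar> + \<alpha> + 1) * u" using u1 by (intro mult_right_mono) auto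
  moreover have "\<beta> * u \<le> \<bar>\<beta>\<bar> * u" using u1 by (intro mult_right_mono) auto
  moreover have "\<alpha> \<le> \<alpha> * u" using u1 \<alpha>_nonneg by (simp add: mult_le_cancel_left1)
  moreover have "(- \<gamma> * u) * u = - (\<gamma> * u\<^sup>2)"
    "(2 * \<bar>\<beta>\<bar> + \<alpha> + 1) * u = 2 * (\<bar>\<beta>\<bar> * u) + \<alpha> * u + u"
    by (simp_all add: power2_eq_square distrib_right)
  ultimately have "\<gamma> * u\<^sup>2 + 2 * \<beta> * u + \<alpha> < 0" using u1 by linarith
  then show False using form[of u] by linarith
qed

text \<open>The quadratic in \<open>form\<close> is nonnegative on the whole line, so its
  discriminant is nonpositive: evaluate it at its minimum. For \<gamma> = 0 it is affine and must be
  constant.\<close>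

lemma \<beta>_le: "\<beta>\<^sup>2 \<le> \<alpha> * \<gamma>"
proof (cases "\<gamma> = 0")
  case True
  have "\<beta> = 0"
  proof (rule ccontr)
    assume "\<beta> \<noteq> 0"
    then show False using form[of "- (\<alpha> + 1) / (2 * \<beta>)"] True by simp
  qed
  then show ?thesis using True by simp
next
  case False
  then have g: "\<gamma> > 0" using \<gamma>_nonneg by simp
  have "\<gamma> * (\<gamma> * (- \<beta> / \<gamma>)\<^sup>2 + 2 * \<beta> * (- \<beta> / \<gamma>) + \<alpha>) = \<alpha> * \<gamma> - \<beta>\<^sup>2"
    using g by (simp add: field_simps power2_eq_square)
  then show ?thesis using mult_nonneg_nonneg[OF \<gamma>_nonneg form[of "- \<beta> / \<gamma>"]] by linarith
qed

text \<open>Laplace expansion of the vanishing determinant with rows (c, b, a), (c, b, a), (f, e,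
  d).\<close>

lemma syzygy: "b * \<beta> = a * \<alpha> + c * \<gamma>"
  by (simp add: \<alpha>_def \<beta>_def \<gamma>_def algebra_simps)

lemma \<beta>_nonneg: "\<beta> \<ge> 0"
proof (cases "b = 0")
  case True
  have "b * \<beta> = 0" unfolding True by simp
  then have "c * \<gamma> = 0"
    using syzygy mult_nonneg_nonneg[OF a_nonneg \<alpha>_nonneg]
      mult_nonneg_nonneg[OF less_imp_le[OF c_pos] \<gamma>_nonneg] by linarith
  then have "\<gamma> = 0" using c_pos by simp
  then show ?thesis using \<beta>_le by simp
next
  case False
  then have "b > 0" using b_nonneg by simp
  moreover have "b * \<beta> \<ge> 0"
    using syzygy a_nonneg \<alpha>_nonneg c_pos \<gamma>_nonneg by simp
  ultimately show ?thesis by (simp add: zero_le_mult_iff)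
qed

text \<open>After multiplication by \<beta> this combines the discriminant bound with the syzygy. It
  gives the sign of the lowest-order term in \<open>ratio_convex\<close>.\<close>

lemma \<alpha>b_ge: "\<alpha> * b \<ge> \<beta> * c"
proof (cases "\<beta> = 0")
  case True
  then show ?thesis using \<alpha>_nonneg b_nonneg by simp
next
  case False
  then have B: "\<beta> > 0" using \<beta>_nonneg by simp
  have "c * \<beta>\<^sup>2 \<le> c * (\<alpha> * \<gamma>)" using \<beta>_le c_pos by (intro mult_left_mono) auto
  also have "\<dots> = \<alpha> * (b * \<beta> - a * \<alpha>)" using syzygy by (simp add: algebra_simps)
  also have "\<dots> \<le> \<alpha> * (b * \<beta>)" using \<alpha>_nonneg a_nonneg by (intro mult_left_mono) auto
  finally have "\<beta> * (\<beta> * c) \<le> \<beta> * (\<alpha> * b)" by (simp add: power2_eq_square algebra_simps)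
  then show ?thesis using B by simp
qed

text \<open>For R = Q / P the numerator of R 0 - R u is u (\<alpha> + \<beta> u).\<close>

lemma ratio_antimono:
  assumes "u \<ge> 0"
  shows "(f + e * u + d * u\<^sup>2) * c \<le> f * (c + b * u + a * u\<^sup>2)"
proof -
  have "f * (c + b * u + a * u\<^sup>2) - (f + e * u + d * u\<^sup>2) * c = u * (\<alpha> + \<beta> * u)"
    by (simp add: \<alpha>_def \<beta>_def power2_eq_square algebra_simps)
  moreover have "u * (\<alpha> + \<beta> * u) \<ge> 0" using assms \<alpha>_nonneg \<beta>_nonneg by simp
  ultimately show ?thesis by linarith
qed

text \<open>Convexity of \<open>R = Q / P\<close> in the form \<open>R u - u R' u \<le> R 0\<close>, with
  \<open>P = c + b u + a u\<^sup>2\<close> and \<open>Q = f + e u + d u\<^sup>2\<close>, cleared of denominators.\<close>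

lemma ratio_convex:
  assumes "u \<ge> 0"
  defines "P \<equiv> c + b * u + a * u\<^sup>2" and "Q \<equiv> f + e * u + d * u\<^sup>2"
    and "P' \<equiv> b + 2 * a * u" and "Q' \<equiv> e + 2 * d * u"
  shows "u * (Q * P' - Q' * P) * c \<le> (f * P - Q * c) * P"
proof -
  have "(f * P - Q * c) * P - u * (Q * P' - Q' * P) * c =
      u * (u * (\<alpha> * b - \<beta> * c) + u\<^sup>2 * (\<beta> * b + a * \<alpha> - c * \<gamma>) + \<beta> * a * u ^ 3)"
    unfolding P_def Q_def P'_def Q'_def \<alpha>_def \<beta>_def \<gamma>_def
    by (simp add: power2_eq_square power3_eq_cube algebra_simps)
  also have "\<dots> = u * (u * (\<alpha> * b - \<beta> * c) + u\<^sup>2 * (2 * (a * \<alpha>)) + \<beta> * a * u ^ 3)"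
    using syzygy by (simp add: algebra_simps)
  also have "\<dots> \<ge> 0"
    using assms(1) \<alpha>b_ge \<alpha>_nonneg \<beta>_nonneg a_nonneg by simp
  finally show ?thesis by linarith
qed

lemma W_nonpos: "(e + 2 * d * u) * (c + b * u + a * u\<^sup>2) \<le> (f + e * u + d * u\<^sup>2) * (b + 2 * a * u)"
  using W[of u] by (simp add: power2_eq_square algebra_simps)

end

section \<open>Stable multiaffine functions\<close>

text \<open>For functions affine in each variable the unit difference is the exact partial derivative.\<close>

definition pderiv_at :: "'i \<Rightarrow> (('i \<Rightarrow> complex) \<Rightarrow> complex) \<Rightarrow> ('i \<Rightarrow> complex) \<Rightarrow> complex" where
  "pderiv_at i F z = F (z(i := z i + 1)) - F z"

text \<open>Stands in for real polynomials of degree at most one in each variable. The index type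
  may be infinite and no coefficients are stored: compatibility with conjugation encodes real
  coefficients, and holomorphy along complex lines supplies continuity and derivatives.\<close>

definition multiaffine :: "(('i \<Rightarrow> complex) \<Rightarrow> complex) \<Rightarrow> bool" where
  "multiaffine F \<longleftrightarrow>
     (\<forall>z i t. F (z(i := z i + t)) = F z + t * pderiv_at i F z) \<and>
     (\<forall>z. F (\<lambda>i. cnj (z i)) = cnj (F z)) \<and>
     (\<forall>z d. (\<lambda>t. F (\<lambda>i. z i + t * d i)) holomorphic_on UNIV)"

definition stable :: "(('i \<Rightarrow> complex) \<Rightarrow> complex) \<Rightarrow> bool" where
  "stable F \<longleftrightarrow> (\<forall>z. (\<forall>i. Im (z i) > 0) \<longrightarrow> F z \<noteq> 0)"

lemma multiaffineI:
  assumes "\<And>z i t. F (z(i := z i + t)) = F z + t * (F (z(i := z i + 1)) - F z)"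
    "\<And>z. F (\<lambda>i. cnj (z i)) = cnj (F z)"
    "\<And>z d. (\<lambda>t. F (\<lambda>i. z i + t * d i)) holomorphic_on UNIV"
  shows "multiaffine F"
  unfolding multiaffine_def pderiv_at_def by (intro conjI allI assms)

lemma multiaffine_update:
  assumes "multiaffine F" shows "F (z(i := z i + t)) = F z + t * pderiv_at i F z"
  using assms[unfolded multiaffine_def, THEN conjunct1, rule_format, of z i t]
  unfolding pderiv_at_def .

lemma multiaffine_cnj: "multiaffine F \<Longrightarrow> F (\<lambda>i. cnj (z i)) = cnj (F z)"
  unfolding multiaffine_def by blast

lemma multiaffine_holomorphic:
  "multiaffine F \<Longrightarrow> (\<lambda>t. F (\<lambda>i. z i + t * d i)) holomorphic_on A"
  unfolding multiaffine_def by (meson holomorphic_on_subset subset_UNIV)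

lemma multiaffine_add:
  assumes F: "multiaffine F" and G: "multiaffine G"
  shows "multiaffine (\<lambda>z. F z + G z)"
proof (rule multiaffineI)
  show "F (z(i := z i + t)) + G (z(i := z i + t)) =
      F z + G z + t * (F (z(i := z i + 1)) + G (z(i := z i + 1)) - (F z + G z))" for z i t
    unfolding multiaffine_update[OF F, of z i t] multiaffine_update[OF G, of z i t]
      pderiv_at_def by (simp add: algebra_simps)
  show "F (\<lambda>i. cnj (z i)) + G (\<lambda>i. cnj (z i)) = cnj (F z + G z)" for z
    by (simp add: multiaffine_cnj[OF F] multiaffine_cnj[OF G])
  show "(\<lambda>t. F (\<lambda>i. z i + t * d i) + G (\<lambda>i. z i + t * d i)) holomorphic_on UNIV" for z d
    by (intro holomorphic_on_add multiaffine_holomorphic F G)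
qed

lemma multiaffine_diff:
  assumes F: "multiaffine F" and G: "multiaffine G"
  shows "multiaffine (\<lambda>z. F z - G z)"
proof (rule multiaffineI)
  show "F (z(i := z i + t)) - G (z(i := z i + t)) =
      F z - G z + t * (F (z(i := z i + 1)) - G (z(i := z i + 1)) - (F z - G z))" for z i t
    unfolding multiaffine_update[OF F, of z i t] multiaffine_update[OF G, of z i t]
      pderiv_at_def by (simp add: algebra_simps)
  show "F (\<lambda>i. cnj (z i)) - G (\<lambda>i. cnj (z i)) = cnj (F z - G z)" for z
    by (simp add: multiaffine_cnj[OF F] multiaffine_cnj[OF G])
  show "(\<lambda>t. F (\<lambda>i. z i + t * d i) - G (\<lambda>i. z i + t * d i)) holomorphic_on UNIV" for z d
    by (intro holomorphic_on_diff multiaffine_holomorphic F G)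
qed

lemma multiaffine_shift:
  assumes "multiaffine F"
  shows "multiaffine (\<lambda>z. F (\<lambda>k. z k + of_real (s k)))"
proof (rule multiaffineI)
  fix z :: "'a \<Rightarrow> complex" and i t
  have eq: "(\<lambda>k. (z(i := z i + t)) k + of_real (s k)) =
      (\<lambda>k. z k + of_real (s k))(i := z i + of_real (s i) + t)" for t
    by (auto simp: algebra_simps)
  show "F (\<lambda>k. (z(i := z i + t)) k + of_real (s k)) =
      F (\<lambda>k. z k + of_real (s k)) + t * (F (\<lambda>k. (z(i := z i + 1)) k + of_real (s k)) -
        F (\<lambda>k. z k + of_real (s k)))"
    unfolding eq by (rule assms[unfolded multiaffine_def pderiv_at_def, THEN conjunct1, rule_format])
next
  fix z :: "'a \<Rightarrow> complex"
  show "F (\<lambda>k. cnj (z k) + of_real (s k)) = cnj (F (\<lambda>k. z k + of_real (s k)))"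
    using multiaffine_cnj[OF assms, of "\<lambda>k. z k + of_real (s k)"] by simp
next
  fix z d :: "'a \<Rightarrow> complex"
  show "(\<lambda>t. F (\<lambda>k. (z k + t * d k) + of_real (s k))) holomorphic_on UNIV"
    using multiaffine_holomorphic[OF assms, of "\<lambda>k. z k + of_real (s k)" d UNIV]
    by (simp add: add_ac)
qed

text \<open>A difference of real shifts, so that closure under shifts and differences yields closure
  under derivatives.\<close>

lemma pderiv_at_shift_eq:
  fixes F :: "('i \<Rightarrow> complex) \<Rightarrow> complex"
  shows
  "pderiv_at i F = (\<lambda>z. F (\<lambda>k. z k + of_real (if k = i then 1 else 0)) - F z)"
proof
  fix z :: "'i \<Rightarrow> complex"
  have "z(i := z i + 1) = (\<lambda>k. z k + of_real (if k = i then 1 else 0))" by auto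
  then show "pderiv_at i F z = F (\<lambda>k. z k + of_real (if k = i then 1 else 0)) - F z"
    by (simp add: pderiv_at_def)
qed

lemma multiaffine_pderiv_at: "multiaffine F \<Longrightarrow> multiaffine (pderiv_at i F)"
  unfolding pderiv_at_shift_eq by (intro multiaffine_diff multiaffine_shift)

lemma pderiv_at_add:
  "pderiv_at i (\<lambda>z. F z + G z) z = pderiv_at i F z + pderiv_at i G z"
  by (simp add: pderiv_at_def)

lemma pderiv_at_commute:
  fixes F :: "('a \<Rightarrow> complex) \<Rightarrow> complex"
  shows "pderiv_at i (pderiv_at j F) = pderiv_at j (pderiv_at i F)"
proof
  fix z :: "'a \<Rightarrow> complex"
  show "pderiv_at i (pderiv_at j F) z = pderiv_at j (pderiv_at i F) z"
  proof (cases "i = j")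
    case False
    then have "z(i := z i + 1, j := z j + 1) = z(j := z j + 1, i := z i + 1)" by auto
    then show ?thesis using False by (simp add: pderiv_at_def)
  qed simp
qed

lemma pderiv_at_self:
  assumes "multiaffine F" shows "pderiv_at i (pderiv_at i F) z = 0"
proof -
  have "F (z(i := z i + 2)) = F z + 2 * pderiv_at i F z"
    using multiaffine_update[OF assms, of z i 2] .
  moreover have "F (z(i := z i + 1)) = F z + 1 * pderiv_at i F z"
    using multiaffine_update[OF assms, of z i 1] .
  moreover have "pderiv_at i (pderiv_at i F) z =
      F (z(i := z i + 2)) - 2 * F (z(i := z i + 1)) + F z"
    by (simp add: pderiv_at_def add.assoc)
  ultimately show ?thesis by simp
qed

lemma stable_shift:
  assumes "stable F" shows "stable (\<lambda>z. F (\<lambda>k. z k + of_real (s k)))"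
  using assms by (simp add: stable_def)

text \<open>In the i-th variable F is affine, with root at the increment t = - F z / D. By stability
  z i + t lies outside the open upper half plane, so Im t < 0, that is, Im (F / D) > 0.\<close>

lemma Im_pderiv_at:
  assumes F: "multiaffine F" "stable F" and z: "\<And>k. Im (z k) > 0" and D: "pderiv_at i F z \<noteq> 0"
  shows "Im (pderiv_at i F z * cnj (F z)) < 0"
proof -
  define D where "D = pderiv_at i F z"
  define t where "t = - F z / D"
  have "F (z(i := z i + t)) = 0"
    unfolding multiaffine_update[OF F(1), of z i t] using D by (simp add: t_def D_def)
  then have "\<not> (\<forall>k. Im ((z(i := z i + t)) k) > 0)" using F(2) unfolding stable_def by blast
  then have "Im (z i + t) \<le> 0" using z by (auto split: if_splits)
  then have "Im t < 0" using z[of i] by simp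
  then have "Im (F z / D) > 0" by (simp add: t_def)
  then have "Im (F z * cnj D) > 0"
    by (simp add: Im_complex_div_gt_0)
  then show ?thesis by (simp add: D_def algebra_simps)
qed

text \<open>Limit of the strict inequality: move all coordinates up by the same imaginary amount and
  let it decrease to 0.\<close>

lemma Im_pderiv_at_le:
  assumes F: "multiaffine F" "stable F" and z: "\<And>k. Im (z k) \<ge> 0"
  shows "Im (pderiv_at i F z * cnj (F z)) \<le> 0"
proof -
  let ?z = "\<lambda>t k. z k + complex_of_real t * \<i>"
  have cont: "continuous_on UNIV (\<lambda>t. G (?z t))" if "multiaffine G" for G
  proof -
    have "continuous_on UNIV (\<lambda>t. G (\<lambda>k. z k + t * \<i>))"
      by (rule holomorphic_on_imp_continuous_on[OF multiaffine_holomorphic[OF that]])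
    from continuous_on_compose2[OF this, of UNIV of_real]
    show ?thesis by (simp add: continuous_on_of_real_id)
  qed
  have "continuous_on UNIV (\<lambda>t. Im (pderiv_at i F (?z t) * cnj (F (?z t))))"
    by (intro continuous_intros cont F(1) multiaffine_pderiv_at)
  then have "((\<lambda>t. Im (pderiv_at i F (?z t) * cnj (F (?z t)))) \<longlongrightarrow>
      Im (pderiv_at i F (?z 0) * cnj (F (?z 0)))) (at_right 0)"
    unfolding continuous_on_def by (meson UNIV_I tendsto_within_subset subset_UNIV)
  moreover have "\<forall>\<^sub>F t in at_right 0. Im (pderiv_at i F (?z t) * cnj (F (?z t))) \<le> 0"
    unfolding eventually_at_right_field
  proof (intro exI[of _ 1] conjI allI impI)
    fix t :: real assume "0 < t" "t < 1"
    then have "\<And>k. Im (?z t k) > 0" using z by (simp add: add_nonneg_pos)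
    then show "Im (pderiv_at i F (?z t) * cnj (F (?z t))) \<le> 0"
      using Im_pderiv_at[OF F, of "?z t" i]
      by (cases "pderiv_at i F (?z t) = 0") (simp, metis less_imp_le)
  qed simp
  ultimately have "Im (pderiv_at i F (?z 0) * cnj (F (?z 0))) \<le> 0"
    by (rule tendsto_upperbound) simp
  then show ?thesis by simp
qed

text \<open>At a zero, F equals the sum of the two derivatives. Multiplying by the conjugate of F
  makes one side real, while the other has negative imaginary part, because F z \<noteq> 0 forces
  one derivative to be nonzero.\<close>

lemma stable_avg:
  assumes F: "multiaffine F" "stable F"
  shows "stable (\<lambda>z :: 'a \<Rightarrow> complex. F z - (pderiv_at i F z + pderiv_at j F z))"
  unfolding stable_def
proof (intro allI impI notI)
  fix z :: "'a \<Rightarrow> complex" assume z: "\<forall>k. Im (z k) > 0" and eq: "F z - (pderiv_at i F z + pderiv_at j F z) = 0"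
  have "F z \<noteq> 0" using F(2) z by (auto simp: stable_def)
  then have nz: "pderiv_at i F z \<noteq> 0 \<or> pderiv_at j F z \<noteq> 0" using eq by auto
  have "Im (pderiv_at k F z * cnj (F z)) \<le> 0" for k
    by (rule Im_pderiv_at_le[OF F]) (use z in \<open>auto intro: less_imp_le\<close>)
  moreover have "pderiv_at k F z \<noteq> 0 \<Longrightarrow> Im (pderiv_at k F z * cnj (F z)) < 0" for k
    using Im_pderiv_at[OF F] z by blast
  ultimately have "Im (pderiv_at i F z * cnj (F z)) + Im (pderiv_at j F z * cnj (F z)) < 0"
    using nz by (metis add_less_le_mono add_le_less_mono add.right_neutral)
  also have "Im (pderiv_at i F z * cnj (F z)) + Im (pderiv_at j F z * cnj (F z)) =
      Im ((pderiv_at i F z + pderiv_at j F z) * cnj (F z))"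
    by (simp add: algebra_simps)
  also have "pderiv_at i F z + pderiv_at j F z = F z" using eq by simp
  also have "Im (F z * cnj (F z)) = 0" by simp
  finally show False by simp
qed

section \<open>The barrier functions on the diagonal\<close>

text \<open>\<open>Inl j\<close> and \<open>Inr j\<close> index the two copies of the j-th variable,
  one for each factor of q(z) q(z'). On the diagonal the sum of both partial derivatives is the
  derivative in the j-th coordinate.\<close>

definition pair_deriv ::
  "nat \<Rightarrow> ((nat + nat \<Rightarrow> complex) \<Rightarrow> complex) \<Rightarrow> (nat + nat \<Rightarrow> complex) \<Rightarrow> complex" where
  "pair_deriv j F z = pderiv_at (Inl j) F z + pderiv_at (Inr j) F z"

definition diag :: "(nat \<Rightarrow> 'a) \<Rightarrow> nat + nat \<Rightarrow> 'a" where
  "diag x = case_sum x x"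

text \<open>Multiaffine functions are real at real points, so for them the real part loses
  nothing.\<close>

definition dval :: "((nat + nat \<Rightarrow> complex) \<Rightarrow> complex) \<Rightarrow> (nat \<Rightarrow> real) \<Rightarrow> real" where
  "dval F x = Re (F (\<lambda>k. of_real (diag x k)))"

lemma diag_simps [simp]: "diag x (Inl j) = x j" "diag x (Inr j) = x j"
  by (simp_all add: diag_def)

lemma diag_comp: "f (diag x k) = diag (\<lambda>j. f (x j)) k"
  by (cases k) simp_all

lemma multiaffine_pair_deriv: "multiaffine F \<Longrightarrow> multiaffine (pair_deriv j F)"
  unfolding pair_deriv_def[abs_def] by (intro multiaffine_add multiaffine_pderiv_at)

lemma pair_deriv_commute: "pair_deriv i (pair_deriv j F) z = pair_deriv j (pair_deriv i F) z"
  unfolding pair_deriv_def[abs_def] pderiv_at_add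
  using pderiv_at_commute[of "Inl i" "Inl j" F] pderiv_at_commute[of "Inl i" "Inr j" F]
    pderiv_at_commute[of "Inr i" "Inl j" F] pderiv_at_commute[of "Inr i" "Inr j" F]
  by simp

lemma pair_deriv_twice:
  assumes "multiaffine F"
  shows "pair_deriv j (pair_deriv j F) z = 2 * pderiv_at (Inl j) (pderiv_at (Inr j) F) z"
  unfolding pair_deriv_def[abs_def] pderiv_at_add
  using pderiv_at_commute[of "Inr j" "Inl j" F] pderiv_at_self[OF assms]
  by simp

text \<open>Each of the two copies contributes degree at most one, so the degree along the j-th
  diagonal direction is at most two. The expansion in \<open>diag_expand\<close> is exact for the
  same reason.\<close>

lemma pair_deriv_thrice:
  assumes "multiaffine F"
  shows "pair_deriv j (pair_deriv j (pair_deriv j F)) z = 0"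
proof -
  have "pair_deriv j (pair_deriv j (pair_deriv j F)) z =
      2 * pderiv_at (Inl j) (pderiv_at (Inr j) (pair_deriv j F)) z"
    by (rule pair_deriv_twice[OF multiaffine_pair_deriv[OF assms]])
  also have "pderiv_at (Inr j) (pair_deriv j F) = pderiv_at (Inr j) (pderiv_at (Inl j) F)"
    unfolding pair_deriv_def[abs_def] using pderiv_at_self[OF assms] by (auto simp: pderiv_at_add)
  also have "pderiv_at (Inl j) (pderiv_at (Inr j) (pderiv_at (Inl j) F)) z = 0"
    unfolding pderiv_at_commute[of "Inr j"]
    by (rule pderiv_at_self[OF multiaffine_pderiv_at[OF assms]])
  finally show ?thesis by simp
qed

lemma diag_update: "diag (z(j := t)) = (diag z)(Inl j := t, Inr j := t)"
proof
  fix k show "diag (z(j := t)) k = ((diag z)(Inl j := t, Inr j := t)) k"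
    by (cases k) auto
qed

lemma diag_expand:
  assumes F: "multiaffine F"
  shows "F (diag (z(j := z j + t))) = F (diag z) + t * pair_deriv j F (diag z) +
    t\<^sup>2 / 2 * pair_deriv j (pair_deriv j F) (diag z)"
proof -
  let ?z = "diag z"
  have "diag (z(j := z j + t)) = (?z(Inl j := ?z (Inl j) + t))(Inr j := (?z(Inl j := ?z (Inl j) + t)) (Inr j) + t)"
    by (simp add: diag_update)
  then have "F (diag (z(j := z j + t))) =
      F (?z(Inl j := ?z (Inl j) + t)) + t * pderiv_at (Inr j) F (?z(Inl j := ?z (Inl j) + t))"
    using multiaffine_update[OF F, of "?z(Inl j := ?z (Inl j) + t)" "Inr j" t] by metis
  also have "F (?z(Inl j := ?z (Inl j) + t)) = F ?z + t * pderiv_at (Inl j) F ?z"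
    by (rule multiaffine_update[OF F, of ?z "Inl j" t])
  also have "pderiv_at (Inr j) F (?z(Inl j := ?z (Inl j) + t)) =
      pderiv_at (Inr j) F ?z + t * pderiv_at (Inl j) (pderiv_at (Inr j) F) ?z"
    by (rule multiaffine_update[OF multiaffine_pderiv_at[OF F], of "Inr j" ?z "Inl j" t])
  finally have "F (diag (z(j := z j + t))) = F ?z + t * pderiv_at (Inl j) F ?z +
      t * (pderiv_at (Inr j) F ?z + t * pderiv_at (Inl j) (pderiv_at (Inr j) F) ?z)" .
  then show ?thesis
    unfolding pair_deriv_twice[OF F] by (rule trans) (simp add: pair_deriv_def power2_eq_square algebra_simps)
qed

lemma multiaffine_real:
  assumes "multiaffine F" shows "F (\<lambda>k. of_real (x k)) = of_real (Re (F (\<lambda>k. of_real (x k))))"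
proof -
  have "cnj (F (\<lambda>k. of_real (x k))) = F (\<lambda>k. of_real (x k))"
    using multiaffine_cnj[OF assms, of "\<lambda>k. of_real (x k)"] by simp
  then show ?thesis by (metis complex_cnj_cancel_iff complex_is_Real_iff Reals_cnj_iff of_real_Re)
qed

lemma dval_eq: "multiaffine F \<Longrightarrow> F (diag (\<lambda>j. of_real (x j))) = of_real (dval F x)"
  using multiaffine_real[of F "diag x"] by (simp add: dval_def diag_comp[of of_real])

lemma dval_expand:
  assumes F: "multiaffine F"
  shows "dval F (x(j := x j + u)) = dval F x + dval (pair_deriv j F) x * u +
    dval (pair_deriv j (pair_deriv j F)) x / 2 * u\<^sup>2"
proof -
  have "complex_of_real (dval F (x(j := x j + u))) =
      F (diag ((\<lambda>k. complex_of_real (x k))(j := complex_of_real (x j) + of_real u)))"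
    unfolding dval_eq[OF F, symmetric] by (intro arg_cong[where f = F] arg_cong[where f = diag]) auto
  also have "\<dots> = of_real (dval F x + dval (pair_deriv j F) x * u +
      dval (pair_deriv j (pair_deriv j F)) x / 2 * u\<^sup>2)"
    unfolding diag_expand[OF F, of "\<lambda>k. complex_of_real (x k)"]
    using F by (simp add: dval_eq multiaffine_pair_deriv)
  finally show ?thesis by (simp only: of_real_eq_iff)
qed

lemma dval_pair_expand:
  assumes F: "multiaffine F"
  shows "dval (pair_deriv j F) (x(j := x j + u)) =
    dval (pair_deriv j F) x + dval (pair_deriv j (pair_deriv j F)) x * u"
  using dval_expand[OF multiaffine_pair_deriv[OF F], where j = j and x = x and u = u] pair_deriv_thrice[OF F]
  by (simp add: dval_def)

text \<open>The inequality \<open>\<partial>\<^sub>j(\<partial>\<^sub>i F / F) \<le> 0\<close> on the real diagonal (for \<open>i = j\<close> included),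
  expanded along the \<open>j\<close>-th diagonal direction.\<close>

lemma wronskian_nonpos:
  fixes x :: "nat \<Rightarrow> real" and i j :: nat and u :: real
  assumes F: "multiaffine F" "stable F"
  defines "E \<equiv> pair_deriv"
  defines "a \<equiv> dval (E j (E j F)) x / 2" and "b \<equiv> dval (E j F) x" and "c \<equiv> dval F x"
  defines "d \<equiv> dval (E j (E j (E i F))) x / 2" and "e \<equiv> dval (E j (E i F)) x"
    and "f \<equiv> dval (E i F) x"
  shows "(d * b - e * a) * u\<^sup>2 + 2 * (d * c - f * a) * u + (e * c - f * b) \<le> 0"
proof (rule tangent_form_nonpos)
  fix u v :: real assume v: "v > 0"
  define y where "y = (\<lambda>k. complex_of_real (x k))"
  define z where "z = diag (y(j := y j + Complex u v))"
  have Im: "Im (z k) \<ge> 0" for k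
    using v by (cases k) (auto simp: z_def y_def)
  have "F z = of_real c + of_real b * Complex u v + of_real a * (Complex u v)\<^sup>2"
    unfolding z_def diag_expand[OF F(1)] unfolding a_def b_def c_def E_def y_def
    using F by (simp add: dval_eq multiaffine_pair_deriv)
  moreover have "E i F z = of_real f + of_real e * Complex u v + of_real d * (Complex u v)\<^sup>2"
    unfolding z_def E_def diag_expand[OF multiaffine_pair_deriv[OF F(1)]]
    unfolding d_def e_def f_def E_def y_def
    using F by (simp add: dval_eq multiaffine_pair_deriv)
  moreover have "Im (E i F z * cnj (F z)) \<le> 0"
    using Im_pderiv_at_le[OF F, of z "Inl i", OF Im] Im_pderiv_at_le[OF F, of z "Inr i", OF Im]
    by (simp add: E_def pair_deriv_def algebra_simps)
  ultimately show "Im ((of_real f + of_real e * Complex u v + of_real d * (Complex u v)\<^sup>2) *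
      cnj (of_real c + of_real b * Complex u v + of_real a * (Complex u v)\<^sup>2)) \<le> 0"
    by simp
qed

text \<open>P and Q are \<open>F\<close> and its i-th derivative along the j-th diagonal direction.
  Condition \<open>V\<close> is the Wronskian inequality for i = j, where the third derivative
  vanishes.\<close>

lemma quadratic_ratio_dval:
  assumes F: "multiaffine F" "stable F"
    and pos: "\<And>u. u \<ge> 0 \<Longrightarrow> dval F (x(j := x j + u)) > 0"
  defines "E \<equiv> pair_deriv"
  shows "quadratic_ratio (dval (E j (E j F)) x / 2) (dval (E j F) x) (dval F x)
    (dval (E j (E j (E i F))) x / 2) (dval (E j (E i F)) x) (dval (E i F) x)"
proof
  fix u
  show "0 < dval F x + dval (E j F) x * u + dval (E j (E j F)) x / 2 * u\<^sup>2" if "0 \<le> u"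
    using pos[OF that] unfolding dval_expand[OF F(1)] E_def .
  have "dval (E j (E j (E j F))) x = 0"
    unfolding E_def dval_def using pair_deriv_thrice[OF F(1)] by simp
  then show "2 * (dval (E j (E j F)) x / 2) *
      (dval F x + dval (E j F) x * u + dval (E j (E j F)) x / 2 * u\<^sup>2) \<le>
      (dval (E j F) x + 2 * (dval (E j (E j F)) x / 2) * u)\<^sup>2"
    using wronskian_nonpos[OF F, where i = j and j = j and x = x and u = u] unfolding E_def
    by (simp add: power2_eq_square algebra_simps)
qed (unfold E_def, rule wronskian_nonpos[OF F])

lemma barrier_antimono:
  assumes F: "multiaffine F" "stable F"
    and posF: "\<And>u. u \<ge> 0 \<Longrightarrow> dval F (x(j := x j + u)) > 0" and u: "u \<ge> 0"
  shows "dval (pair_deriv i F) (x(j := x j + u)) / dval F (x(j := x j + u)) \<le>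
    dval (pair_deriv i F) x / dval F x"
proof -
  interpret quadratic_ratio "dval (pair_deriv j (pair_deriv j F)) x / 2" "dval (pair_deriv j F) x"
    "dval F x" "dval (pair_deriv j (pair_deriv j (pair_deriv i F))) x / 2"
    "dval (pair_deriv j (pair_deriv i F)) x" "dval (pair_deriv i F) x"
    by (rule quadratic_ratio_dval[OF F posF])
  have "dval (pair_deriv i F) (x(j := x j + u)) * dval F x \<le>
      dval (pair_deriv i F) x * dval F (x(j := x j + u))"
    using ratio_antimono[OF u]
    unfolding dval_expand[OF F(1)] dval_expand[OF multiaffine_pair_deriv[OF F(1)]] .
  then show ?thesis using posF[OF u] c_pos by (simp add: field_simps)
qed

text \<open>For multiaffine F, \<open>avg_op_eq\<close> shows this to be the mean of two shifts by
  -2, one for each copy of the j-th variable: the two ways of assigning index j to a block.\<close>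

definition avg_op ::
  "nat \<Rightarrow> ((nat + nat \<Rightarrow> complex) \<Rightarrow> complex) \<Rightarrow> (nat + nat \<Rightarrow> complex) \<Rightarrow> complex" where
  "avg_op j F z = F z - pair_deriv j F z"

lemma multiaffine_avg_op: "multiaffine F \<Longrightarrow> multiaffine (avg_op j F)"
  unfolding avg_op_def[abs_def] by (intro multiaffine_diff multiaffine_pair_deriv)

lemma stable_avg_op: "multiaffine F \<Longrightarrow> stable F \<Longrightarrow> stable (avg_op j F)"
  unfolding avg_op_def[abs_def] pair_deriv_def by (rule stable_avg)

lemma dval_avg_op: "dval (avg_op j F) x = dval F x - dval (pair_deriv j F) x"
  by (simp add: dval_def avg_op_def)

lemma pair_deriv_avg_op:
  "pair_deriv i (avg_op j F) z = pair_deriv i F z - pair_deriv j (pair_deriv i F) z"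
proof -
  have "pair_deriv i (avg_op j F) z = pair_deriv i F z - pair_deriv i (pair_deriv j F) z"
    unfolding avg_op_def[abs_def] by (simp add: pair_deriv_def pderiv_at_def)
  then show ?thesis by (simp only: pair_deriv_commute)
qed

text \<open>With R = Q / P along direction j, the left side is R - R' P / (P - P') at u. The bound
  on the barrier gives P / (P - P') \<le> u, and R' \<le> 0, so the left side is at most R - u R',
  which convexity bounds by R 0.\<close>

lemma barrier_step:
  assumes F: "multiaffine F" "stable F"
    and posF: "\<And>u. u \<ge> 0 \<Longrightarrow> dval F (x(j := x j + u)) > 0" and u: "u > 0"
    and bound: "dval (pair_deriv j F) x / dval F x \<le> 1 - 1 / u"
  shows "dval (pair_deriv i (avg_op j F)) (x(j := x j + u)) / dval (avg_op j F) (x(j := x j + u)) \<le>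
    dval (pair_deriv i F) x / dval F x"
proof -
  interpret quadratic_ratio "dval (pair_deriv j (pair_deriv j F)) x / 2" "dval (pair_deriv j F) x"
    "dval F x" "dval (pair_deriv j (pair_deriv j (pair_deriv i F))) x / 2"
    "dval (pair_deriv j (pair_deriv i F)) x" "dval (pair_deriv i F) x"
    by (rule quadratic_ratio_dval[OF F posF])
  let ?y = "x(j := x j + u)"
  define P where "P = dval F ?y"
  define P' where "P' = dval (pair_deriv j F) ?y"
  define Q where "Q = dval (pair_deriv i F) ?y"
  define Q' where "Q' = dval (pair_deriv j (pair_deriv i F)) ?y"
  define c where "c = dval F x"
  define f where "f = dval (pair_deriv i F) x"
  have P: "P > 0" using posF[of u] u by (simp add: P_def)
  have c: "c > 0" using c_pos by (simp add: c_def)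
  have "P' / P \<le> 1 - 1 / u"
    using barrier_antimono[OF F posF less_imp_le[OF u], of j] bound by (simp add: P_def P'_def)
  then have gap: "P \<le> u * (P - P')" using P u by (simp add: field_simps)
  then have PP': "P - P' > 0" using P u by (metis less_le_trans zero_less_mult_pos)
  have P_eq: "P = dval F x + dval (pair_deriv j F) x * u + dval (pair_deriv j (pair_deriv j F)) x / 2 * u\<^sup>2"
    and P'_eq: "P' = dval (pair_deriv j F) x + 2 * (dval (pair_deriv j (pair_deriv j F)) x / 2) * u"
    and Q_eq: "Q = dval (pair_deriv i F) x + dval (pair_deriv j (pair_deriv i F)) x * u +
      dval (pair_deriv j (pair_deriv j (pair_deriv i F))) x / 2 * u\<^sup>2"
    and Q'_eq: "Q' = dval (pair_deriv j (pair_deriv i F)) x +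
      2 * (dval (pair_deriv j (pair_deriv j (pair_deriv i F))) x / 2) * u"
    unfolding P_def P'_def Q_def Q'_def
    using dval_expand[OF F(1)] dval_expand[OF multiaffine_pair_deriv[OF F(1)]]
      dval_pair_expand[OF F(1)] dval_pair_expand[OF multiaffine_pair_deriv[OF F(1)]] by simp_all
  have W: "Q' * P \<le> Q * P'"
    using W_nonpos[of u] unfolding P_eq P'_eq Q_eq Q'_eq .
  have C: "u * (Q * P' - Q' * P) * c \<le> (f * P - Q * c) * P"
    using ratio_convex[of u] u unfolding P_eq P'_eq Q_eq Q'_eq c_def f_def by simp
  have "P * ((Q * P' - Q' * P) * c) \<le> (u * (P - P')) * ((Q * P' - Q' * P) * c)"
    using gap W c by (intro mult_right_mono) auto
  also have "\<dots> = (P - P') * (u * (Q * P' - Q' * P) * c)" by (simp add: algebra_simps)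
  also have "\<dots> \<le> (P - P') * ((f * P - Q * c) * P)"
    using C PP' by (intro mult_left_mono) auto
  finally have "P * ((Q * P' - Q' * P) * c) \<le> P * ((P - P') * (f * P - Q * c))"
    by (simp add: algebra_simps)
  then have "(Q * P' - Q' * P) * c \<le> (P - P') * (f * P - Q * c)" using P by simp
  then have "P * ((Q - Q') * c) \<le> P * (f * (P - P'))" by (simp add: algebra_simps)
  then have "(Q - Q') * c \<le> f * (P - P')" using P by simp
  then have "(Q - Q') / (P - P') \<le> f / c" using PP' c by (simp add: field_simps)
  moreover have "dval (pair_deriv i (avg_op j F)) ?y = Q - Q'"
    by (simp add: dval_def pair_deriv_avg_op Q_def Q'_def)
  ultimately show ?thesis by (simp add: dval_avg_op P_def P'_def c_def f_def)
qed

section \<open>Barriers under repeated averaging\<close>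

definition depends_below :: "nat \<Rightarrow> ((nat + nat \<Rightarrow> complex) \<Rightarrow> complex) \<Rightarrow> bool" where
  "depends_below M F \<longleftrightarrow>
     (\<forall>z z'. (\<forall>i<M. z (Inl i) = z' (Inl i) \<and> z (Inr i) = z' (Inr i)) \<longrightarrow> F z = F z')"

text \<open>In the language of the barrier method, b lies above the roots of F. Only coordinates
  below M are constrained, which suits functions satisfying \<open>depends_below M\<close>.\<close>

definition positive_above ::
  "nat \<Rightarrow> ((nat + nat \<Rightarrow> complex) \<Rightarrow> complex) \<Rightarrow> (nat \<Rightarrow> real) \<Rightarrow> bool" where
  "positive_above M F b \<longleftrightarrow> (\<forall>x. (\<forall>i<M. b i \<le> x i) \<longrightarrow> dval F x > 0)"

lemma depends_belowD:
  "depends_below M F \<Longrightarrow> (\<And>i. i < M \<Longrightarrow> z (Inl i) = z' (Inl i)) \<Longrightarrow>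
    (\<And>i. i < M \<Longrightarrow> z (Inr i) = z' (Inr i)) \<Longrightarrow> F z = F z'"
  unfolding depends_below_def by blast

lemma depends_below_pderiv_at:
  assumes "depends_below M F" shows "depends_below M (pderiv_at k F)"
  unfolding depends_below_def pderiv_at_def
proof (intro allI impI)
  fix z z' :: "nat + nat \<Rightarrow> complex"
  assume eq: "\<forall>i<M. z (Inl i) = z' (Inl i) \<and> z (Inr i) = z' (Inr i)"
  have "F z = F z'" by (rule depends_belowD[OF assms]) (use eq in auto)
  moreover have "F (z(k := z k + 1)) = F (z'(k := z' k + 1))"
    by (rule depends_belowD[OF assms]) (use eq in auto)
  ultimately show "F (z(k := z k + 1)) - F z = F (z'(k := z' k + 1)) - F z'" by simp
qed

lemma depends_below_pair_deriv:
  assumes "depends_below M F" shows "depends_below M (pair_deriv k F)"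
  unfolding depends_below_def pair_deriv_def
proof (intro allI impI)
  fix z z' :: "nat + nat \<Rightarrow> complex"
  assume eq: "\<forall>i<M. z (Inl i) = z' (Inl i) \<and> z (Inr i) = z' (Inr i)"
  have "pderiv_at l F z = pderiv_at l F z'" for l
    by (rule depends_belowD[OF depends_below_pderiv_at[OF assms]]) (use eq in auto)
  then show "pderiv_at (Inl k) F z + pderiv_at (Inr k) F z =
      pderiv_at (Inl k) F z' + pderiv_at (Inr k) F z'" by simp
qed

lemma depends_below_avg_op:
  assumes "depends_below M F" shows "depends_below M (avg_op k F)"
  unfolding depends_below_def avg_op_def
proof (intro allI impI)
  fix z z' :: "nat + nat \<Rightarrow> complex"
  assume eq: "\<forall>i<M. z (Inl i) = z' (Inl i) \<and> z (Inr i) = z' (Inr i)"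
  have "F z = F z'" by (rule depends_belowD[OF assms]) (use eq in auto)
  moreover have "pair_deriv k F z = pair_deriv k F z'"
    by (rule depends_belowD[OF depends_below_pair_deriv[OF assms]]) (use eq in auto)
  ultimately show "F z - pair_deriv k F z = F z' - pair_deriv k F z'" by simp
qed

lemma dval_cong:
  assumes "depends_below M F" "\<And>i. i < M \<Longrightarrow> x i = y i"
  shows "dval F x = dval F y"
  unfolding dval_def using assms(2)
  by (intro arg_cong[where f = Re] depends_belowD[OF assms(1)]) auto

text \<open>The coordinates are raised from b to x one at a time by \<open>barrier_antimono\<close>.
  The last point \<open>y M\<close> agrees with x below M, where F and its derivative read their
  arguments.\<close>

lemma barrier_antimono_above:
  assumes F: "multiaffine F" "stable F" and dep: "depends_below M F"
    and pos: "positive_above M F b" and x: "\<And>j. j < M \<Longrightarrow> b j \<le> x j"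
  shows "dval (pair_deriv i F) x / dval F x \<le> dval (pair_deriv i F) b / dval F b"
proof -
  define y where "y k = (\<lambda>j. if j < k then x j else b j)" for k :: nat
  have "dval (pair_deriv i F) (y k) / dval F (y k) \<le> dval (pair_deriv i F) b / dval F b"
    if "k \<le> M" for k
    using that
  proof (induction k)
    case 0
    then show ?case by (simp add: y_def)
  next
    case (Suc k)
    have y: "y (Suc k) = (y k)(k := y k k + (x k - b k))"
      by (auto simp: y_def fun_eq_iff less_Suc_eq)
    have "dval F ((y k)(k := y k k + u)) > 0" if "u \<ge> 0" for u
      using pos that x unfolding positive_above_def by (auto simp: y_def add_increasing2)
    then have "dval (pair_deriv i F) (y (Suc k)) / dval F (y (Suc k)) \<le>
        dval (pair_deriv i F) (y k) / dval F (y k)"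
      unfolding y using x[of k] Suc.prems by (intro barrier_antimono F) auto
    also have "\<dots> \<le> dval (pair_deriv i F) b / dval F b" using Suc by simp
    finally show ?case .
  qed
  from this[of M] have *: "dval (pair_deriv i F) (y M) / dval F (y M) \<le>
      dval (pair_deriv i F) b / dval F b" by simp
  have "dval F (y M) = dval F x" "dval (pair_deriv i F) (y M) = dval (pair_deriv i F) x"
    by (auto intro!: dval_cong[OF dep] dval_cong[OF depends_below_pair_deriv[OF dep]] simp: y_def)
  with * show ?thesis by simp
qed

primrec avg_iter ::
  "((nat + nat \<Rightarrow> complex) \<Rightarrow> complex) \<Rightarrow> nat \<Rightarrow> (nat + nat \<Rightarrow> complex) \<Rightarrow> complex" where
  "avg_iter H 0 = H"
| "avg_iter H (Suc k) = avg_op k (avg_iter H k)"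

lemma multiaffine_avg_iter: "multiaffine H \<Longrightarrow> multiaffine (avg_iter H k)"
  by (induction k) (simp_all add: multiaffine_avg_op)

lemma stable_avg_iter: "multiaffine H \<Longrightarrow> stable H \<Longrightarrow> stable (avg_iter H k)"
  by (induction k) (simp_all add: stable_avg_op multiaffine_avg_iter)

lemma depends_below_avg_iter: "depends_below M H \<Longrightarrow> depends_below M (avg_iter H k)"
  by (induction k) (simp_all add: depends_below_avg_op)

text \<open>The \<open>k\<close>-th operator moves the \<open>k\<close>-th coordinate of the barrier point from \<open>t\<close> to \<open>t + \<delta>\<close>; the barrier
  functions of the remaining indices do not increase.\<close>

lemma avg_iter_positive_above:
  assumes H: "multiaffine H" "stable H" "depends_below M H"
    and pos: "positive_above M H (\<lambda>_. t)" and \<delta>: "\<delta> > 0"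
    and bound: "\<And>i. i < M \<Longrightarrow> dval (pair_deriv i H) (\<lambda>_. t) / dval H (\<lambda>_. t) \<le> 1 - 1 / \<delta>"
  shows "positive_above M (avg_iter H M) (\<lambda>_. t + \<delta>)"
proof -
  define b where "b k = (\<lambda>i. if i < k then t + \<delta> else t)" for k :: nat
  have "positive_above M (avg_iter H k) (b k) \<and> (\<forall>i. k \<le> i \<longrightarrow> i < M \<longrightarrow>
      dval (pair_deriv i (avg_iter H k)) (b k) / dval (avg_iter H k) (b k) \<le> 1 - 1 / \<delta>)"
    if "k \<le> M" for k
    using that
  proof (induction k)
    case 0
    then show ?case using pos bound by (simp add: b_def)
  next
    case (Suc k)
    define F where "F = avg_iter H k"
    have F: "multiaffine F" "stable F" "depends_below M F"
      unfolding F_def using H multiaffine_avg_iter stable_avg_iter depends_below_avg_iter by blast+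
    have posF: "positive_above M F (b k)"
      and boundF: "\<And>i. k \<le> i \<Longrightarrow> i < M \<Longrightarrow> dval (pair_deriv i F) (b k) / dval F (b k) \<le> 1 - 1 / \<delta>"
      using Suc by (auto simp: F_def)
    have b: "b (Suc k) = (b k)(k := b k k + \<delta>)"
      by (auto simp: b_def fun_eq_iff less_Suc_eq)
    have "positive_above M (avg_op k F) (b (Suc k))"
      unfolding positive_above_def
    proof (intro allI impI)
      fix x assume x: "\<forall>i<M. b (Suc k) i \<le> x i"
      have x': "b k i \<le> x i" if "i < M" for i
        using x[rule_format, OF that] \<delta> by (auto simp: b_def split: if_splits)
      then have P: "dval F x > 0" using posF by (simp add: positive_above_def)
      \<comment> \<open>A logarithmic derivative below 1 keeps F minus its k-th derivative
        positive.\<close>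
      have "dval (pair_deriv k F) x / dval F x \<le> 1 - 1 / \<delta>"
        using barrier_antimono_above[OF F posF x', of k] boundF[of k] Suc.prems by linarith
      also have "\<dots> < 1" using \<delta> by simp
      finally show "dval (avg_op k F) x > 0" using P by (simp add: dval_avg_op)
    qed
    moreover have "dval (pair_deriv i (avg_op k F)) (b (Suc k)) / dval (avg_op k F) (b (Suc k)) \<le> 1 - 1 / \<delta>"
      if "Suc k \<le> i" "i < M" for i
    proof -
      have "dval F ((b k)(k := b k k + u)) > 0" if "u \<ge> 0" for u
        using posF that unfolding positive_above_def by (auto simp: b_def)
      then have "dval (pair_deriv i (avg_op k F)) (b (Suc k)) / dval (avg_op k F) (b (Suc k)) \<le>
          dval (pair_deriv i F) (b k) / dval F (b k)"
        unfolding b using Suc.prems by (intro barrier_step F \<delta> boundF) auto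
      also have "\<dots> \<le> 1 - 1 / \<delta>" using that by (intro boundF) auto
      finally show ?thesis .
    qed
    ultimately show ?case by (simp add: F_def)
  qed
  from this[of M] show ?thesis by (simp add: positive_above_def b_def)
qed

section \<open>Selecting a branch\<close>

text \<open>The product of Q and the conjugate of P at x + iv is real for v = 0 and has imaginary
  part \<le> 0 for v > 0, so this imaginary part cannot have positive slope at 0. The slope is the
  Wronskian Q' P - Q P' at x.\<close>

lemma real_line_wronskian_nonpos:
  fixes P Q :: "complex \<Rightarrow> complex"
  assumes P: "P holomorphic_on UNIV" "\<And>z. P (cnj z) = cnj (P z)"
    and Q: "Q holomorphic_on UNIV" "\<And>z. Q (cnj z) = cnj (Q z)"
    and Im: "\<And>z. Im z > 0 \<Longrightarrow> Im (Q z * cnj (P z)) \<le> 0"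
  shows "Im (\<i> * (deriv Q (of_real x) * P (of_real x) - Q (of_real x) * deriv P (of_real x))) \<le> 0"
proof (rule ccontr)
  let ?x = "complex_of_real x"
  \<comment> \<open>The reflected argument x - iv replaces conjugation, so the product rule applies
    to holomorphic factors.\<close>
  define \<phi> where "\<phi> v = Im (Q (?x + \<i> * of_real v) * P (?x - \<i> * of_real v))" for v
  define D where "D = Im (\<i> * (deriv Q ?x * P ?x - Q ?x * deriv P ?x))"
  assume "\<not> ?thesis"
  then have D: "D > 0" by (simp add: D_def)
  have dQ: "(Q has_field_derivative deriv Q ?x) (at (?x + \<i> * of_real 0))"
    and dP: "(P has_field_derivative deriv P ?x) (at (?x - \<i> * of_real 0))"
    using P(1) Q(1) by (auto intro: holomorphic_derivI)
  have "((\<lambda>v. ?x + \<i> * of_real v) has_vector_derivative \<i>) (at 0)"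
    and "((\<lambda>v. ?x - \<i> * of_real v) has_vector_derivative - \<i>) (at 0)"
    by (auto intro!: derivative_eq_intros simp: has_vector_derivative_def scaleR_conv_of_real)
  from field_vector_diff_chain_at[OF this(1) dQ] field_vector_diff_chain_at[OF this(2) dP]
  have "((\<lambda>v. Q (?x + \<i> * of_real v)) has_vector_derivative \<i> * deriv Q ?x) (at 0)"
    and "((\<lambda>v. P (?x - \<i> * of_real v)) has_vector_derivative - \<i> * deriv P ?x) (at 0)"
    by (simp_all add: o_def)
  from has_vector_derivative_mult[OF this]
  have "((\<lambda>v. Q (?x + \<i> * of_real v) * P (?x - \<i> * of_real v)) has_vector_derivative
      \<i> * (deriv Q ?x * P ?x - Q ?x * deriv P ?x)) (at 0)"
    by (rule has_vector_derivative_eq_rhs) (simp add: algebra_simps)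
  then have "(\<phi> has_real_derivative D) (at 0)"
    unfolding \<phi>_def D_def has_real_derivative_iff_has_vector_derivative
    by (rule bounded_linear.has_vector_derivative[OF bounded_linear_Im])
  from DERIV_pos_inc_right[OF this D] obtain d where d: "d > 0"
    "\<And>h. h > 0 \<Longrightarrow> h < d \<Longrightarrow> \<phi> 0 < \<phi> (0 + h)" by blast
  have "cnj (Q ?x) = Q ?x" "cnj (P ?x) = P ?x" using P(2)[of ?x] Q(2)[of ?x] by simp_all
  then have "Im (Q ?x) = 0" "Im (P ?x) = 0" by (simp_all add: complex_eq_iff)
  then have "\<phi> 0 = 0" by (simp add: \<phi>_def)
  moreover have "\<phi> (0 + d / 2) \<le> 0"
    using Im[of "?x + \<i> * of_real (d / 2)"] d(1) P(2)[of "?x + \<i> * of_real (d / 2)"] by (simp add: \<phi>_def)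
  ultimately show False using d(2)[of "d / 2"] d(1) by simp
qed

lemma real_line_ratio_antimono:
  fixes P Q :: "complex \<Rightarrow> complex"
  assumes P: "P holomorphic_on UNIV" "\<And>z. P (cnj z) = cnj (P z)"
    and Q: "Q holomorphic_on UNIV" "\<And>z. Q (cnj z) = cnj (Q z)"
    and Im: "\<And>z. Im z > 0 \<Longrightarrow> Im (Q z * cnj (P z)) \<le> 0"
    and pos: "\<And>x. x \<ge> s \<Longrightarrow> Re (P (of_real x)) > 0" and st: "s \<le> t"
  shows "Re (Q (of_real t)) / Re (P (of_real t)) \<le> Re (Q (of_real s)) / Re (P (of_real s))"
proof (rule DERIV_nonpos_imp_nonincreasing[OF st])
  fix x assume x: "s \<le> x" "x \<le> t"
  let ?x = "complex_of_real x"
  have der: "((\<lambda>x. Re (F (of_real x))) has_real_derivative Re (deriv F ?x)) (at x)"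
    if "F holomorphic_on UNIV" for F
  proof -
    have "(F has_field_derivative deriv F ?x) (at (of_real x))"
      using that by (auto intro: holomorphic_derivI)
    from has_vector_derivative_real_field[OF this]
    show ?thesis unfolding has_real_derivative_iff_has_vector_derivative
      by (rule bounded_linear.has_vector_derivative[OF bounded_linear_Re])
  qed
  have nz: "Re (P ?x) \<noteq> 0" using pos[OF x(1)] by simp
  have "cnj (Q ?x) = Q ?x" "cnj (P ?x) = P ?x" using P(2)[of ?x] Q(2)[of ?x] by simp_all
  then have im: "Im (Q ?x) = 0" "Im (P ?x) = 0" by (simp_all add: complex_eq_iff)
  have "Re (deriv Q ?x) * Re (P ?x) - Re (Q ?x) * Re (deriv P ?x) \<le> 0"
    using real_line_wronskian_nonpos[OF P Q Im, of x] im by simp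
  then have "(Re (deriv Q ?x) * Re (P ?x) - Re (Q ?x) * Re (deriv P ?x)) / (Re (P ?x) * Re (P ?x)) \<le> 0"
    by (simp add: divide_nonpos_nonneg)
  with DERIV_divide[OF der[OF Q(1)] der[OF P(1)] nz]
  show "\<exists>y. DERIV (\<lambda>x. Re (Q (of_real x)) / Re (P (of_real x))) x :> y \<and> y \<le> 0" by blast
qed

text \<open>With \<open>P x = F(x 1)\<close> and \<open>Q\<^sub>k x = \<partial>\<^sub>k F(x 1)\<close>, both ratios \<open>Q\<^sub>k / P\<close> decrease to the right of the largest root of
  \<open>P\<close>, and one of them is below \<open>1/2\<close> at \<open>\<beta>\<close>. This takes the place of common interlacing.\<close>

lemma select_branch:
  fixes F :: "('i \<Rightarrow> complex) \<Rightarrow> complex"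
  assumes F: "multiaffine F" "stable F"
    and large: "\<And>x. x \<ge> X \<Longrightarrow> Re (F (\<lambda>_. of_real x)) > 0"
    and avg: "\<And>x. x \<ge> \<beta> \<Longrightarrow> Re (F (\<lambda>_. of_real x) -
      (pderiv_at a F (\<lambda>_. of_real x) + pderiv_at b F (\<lambda>_. of_real x))) > 0"
  shows "\<exists>k\<in>{a, b}. \<forall>x\<ge>\<beta>. Re (F (\<lambda>_. of_real x) - 2 * pderiv_at k F (\<lambda>_. of_real x)) > 0"
proof -
  define P where "P z = F (\<lambda>_. z)" for z
  define Q where "Q k z = pderiv_at k F (\<lambda>_. z)" for k z
  define p where "p x = Re (P (of_real x))" for x
  define q where "q k x = Re (Q k (of_real x))" for k x
  have hol: "(\<lambda>z. G (\<lambda>_. z)) holomorphic_on UNIV" if "multiaffine G" for G :: "('i \<Rightarrow> complex) \<Rightarrow> complex"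
    using multiaffine_holomorphic[OF that, of "\<lambda>_. 0" "\<lambda>_. 1"] by simp
  have P: "P holomorphic_on UNIV" "\<And>z. P (cnj z) = cnj (P z)"
    unfolding P_def using hol[OF F(1)] multiaffine_cnj[OF F(1)] by auto
  have Q: "Q k holomorphic_on UNIV" "\<And>z. Q k (cnj z) = cnj (Q k z)" for k
    unfolding Q_def by (rule hol[OF multiaffine_pderiv_at[OF F(1)]],
        rule multiaffine_cnj[OF multiaffine_pderiv_at[OF F(1)]])
  have Im: "Im z > 0 \<Longrightarrow> Im (Q k z * cnj (P z)) \<le> 0" for k z
    using Im_pderiv_at_le[OF F, of "\<lambda>_. z" k] by (simp add: P_def Q_def)
  have avg': "q a x + q b x < p x" if "x \<ge> \<beta>" for x
    using avg[OF that] by (simp add: p_def q_def P_def Q_def)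
  have mono: "q k t / p t \<le> q k s / p s" if "\<And>x. x \<ge> s \<Longrightarrow> p x > 0" "s \<le> t" for k s t
    using real_line_ratio_antimono[OF P Q Im, of s t k] that by (simp add: p_def q_def)
  have cont: "continuous_on A (\<lambda>x. Re (G (complex_of_real x)))" if "G holomorphic_on UNIV" for G A
    by (intro continuous_on_Re continuous_on_compose2[OF holomorphic_on_imp_continuous_on[OF that]])
       (auto intro!: continuous_intros)
  \<comment> \<open>Beyond X positivity is known, so failures to the right of x would have a last
    point m, with p m = 0. To the right of m the quotients q k / p decrease, hence q k is at least a
    constant times p there, and in the limit q k m \<ge> 0 for both k. This contradicts q a m + q b
    m < p m.\<close>
  have p_pos: "p x > 0" if "x \<ge> \<beta>" for x
  proof (rule ccontr)
    assume "\<not> p x > 0"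
    define S where "S = {x..max x X} \<inter> {y. p y \<le> 0}"
    have "closed ({y. p y \<le> 0})"
      unfolding p_def by (intro closed_Collect_le cont P continuous_on_const)
    then have "compact S" unfolding S_def by (intro compact_Int_closed) auto
    moreover have "x \<in> S" using \<open>\<not> p x > 0\<close> by (simp add: S_def)
    ultimately obtain m where m: "m \<in> S" "\<And>y. y \<in> S \<Longrightarrow> y \<le> m"
      using compact_attains_sup[of S] by blast
    have above: "p y > 0" if "y > m" for y
    proof (rule ccontr)
      assume *: "\<not> p y > 0"
      then have "y < X" using large[of y] by (auto simp: p_def P_def not_less[symmetric])
      then have "y \<in> S" using * that m(1) by (auto simp: S_def)
      then show False using m(2) that by fastforce
    qed
    have mb: "m \<ge> \<beta>" using m(1) that by (simp add: S_def)
    have tend: "((\<lambda>x. Re (G (complex_of_real x))) \<longlongrightarrow> Re (G (of_real m))) (at_right m)"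
      if "G holomorphic_on UNIV" for G
      using cont[OF that, of UNIV] unfolding continuous_on_def by (meson UNIV_I tendsto_within_subset subset_UNIV)
    have ev: "\<forall>\<^sub>F y in at_right m. m < y \<and> y < m + 1"
      by (simp add: eventually_at_right_field) (meson less_add_one)
    have "\<forall>\<^sub>F y in at_right m. 0 \<le> Re (P (of_real y))"
      using ev by eventually_elim (use above in \<open>auto simp: p_def intro: less_imp_le\<close>)
    then have "p m \<ge> 0"
      unfolding p_def by (rule tendsto_lowerbound[OF tend[OF P(1)]]) simp
    then have pm: "p m = 0" using m(1) by (simp add: S_def)
    have "q k m \<ge> q k (m + 1) / p (m + 1) * p m" for k
    proof (rule tendsto_le[OF _ tend[OF Q(1)[of k], folded q_def] tendsto_mult_left[OF tend[OF P(1), folded p_def]]])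
      show "\<forall>\<^sub>F y in at_right m. q k (m + 1) / p (m + 1) * p y \<le> q k y"
        using ev
      proof eventually_elim
        case (elim y)
        then have "q k (m + 1) / p (m + 1) \<le> q k y / p y" by (intro mono above) auto
        then show ?case using above[of y] elim by (simp add: field_simps)
      qed
    qed simp
    from this[of a] this[of b] show False using avg'[OF mb] pm by simp
  qed
  have "q a \<beta> / p \<beta> + q b \<beta> / p \<beta> < 1"
    using avg'[of \<beta>] p_pos[of \<beta>] by (simp add: field_simps)
  then have "q a \<beta> / p \<beta> < 1 / 2 \<or> q b \<beta> / p \<beta> < 1 / 2" by linarith
  then obtain k where k: "k \<in> {a, b}" "q k \<beta> / p \<beta> < 1 / 2" by blast
  have "p x - 2 * q k x > 0" if "x \<ge> \<beta>" for x
  proof -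
    have "q k x / p x \<le> q k \<beta> / p \<beta>" by (intro mono p_pos that)
    then have "q k x / p x < 1 / 2" using k(2) by linarith
    then show ?thesis using p_pos[OF that] by (simp add: field_simps)
  qed
  then show ?thesis using k(1) by (auto simp: p_def q_def P_def Q_def)
qed

text \<open>Supplies the hypothesis \<open>large\<close> of \<open>select_branch\<close>. It ranges
  over all large real points, not only constant ones, so that shifting a single coordinate preserves
  it.\<close>

definition eventually_positive :: "(('i \<Rightarrow> complex) \<Rightarrow> complex) \<Rightarrow> bool" where
  "eventually_positive F \<longleftrightarrow> (\<exists>X. \<forall>x. (\<forall>k. X \<le> x k) \<longrightarrow> Re (F (\<lambda>k. of_real (x k))) > 0)"

lemma pderiv_at_shift:
  "pderiv_at l (\<lambda>z. F (\<lambda>k. z k + s k)) z = pderiv_at l F (\<lambda>k. z k + s k)"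
proof -
  have "(\<lambda>k. (z(l := z l + 1)) k + s k) = (\<lambda>k. z k + s k)(l := z l + s l + 1)"
    by (auto simp: algebra_simps)
  then show ?thesis by (simp add: pderiv_at_def)
qed

lemma avg_op_eq:
  assumes F: "multiaffine F"
  shows "avg_op j F z = (F (z(Inl j := z (Inl j) - 2)) + F (z(Inr j := z (Inr j) - 2))) / 2"
  using multiaffine_update[OF F, of z "Inl j" "-2"] multiaffine_update[OF F, of z "Inr j" "-2"]
  by (simp add: avg_op_def pair_deriv_def)

lemma eventually_positive_avg_op:
  assumes F: "multiaffine F" "eventually_positive F"
  shows "eventually_positive (avg_op j F)"
proof -
  obtain X where X: "\<And>x. (\<And>k. X \<le> x k) \<Longrightarrow> Re (F (\<lambda>k. of_real (x k))) > 0"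
    using F(2) unfolding eventually_positive_def by blast
  have pos: "Re (F ((\<lambda>k. of_real (x k))(l := of_real (x l) - 2))) > 0" if "\<And>k. X + 2 \<le> x k" for x l
  proof -
    have eq: "(\<lambda>k. complex_of_real (x k))(l := of_real (x l) - 2) = (\<lambda>k. of_real ((x(l := x l - 2)) k))"
      by auto
    show ?thesis unfolding eq
    proof (rule X)
      fix k show "X \<le> (x(l := x l - 2)) k" using that[of k] that[of l] by auto
    qed
  qed
  show ?thesis
    unfolding eventually_positive_def
  proof (intro exI[of _ "X + 2"] allI impI)
    fix x :: "nat + nat \<Rightarrow> real" assume "\<forall>k. X + 2 \<le> x k"
    then show "0 < Re (avg_op j F (\<lambda>k. of_real (x k)))"
      unfolding avg_op_eq[OF F(1)] using pos[of x "Inl j"] pos[of x "Inr j"] by simp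
  qed
qed

lemma eventually_positive_avg_iter:
  "multiaffine H \<Longrightarrow> eventually_positive H \<Longrightarrow> eventually_positive (avg_iter H k)"
  by (induction k) (simp_all add: eventually_positive_avg_op multiaffine_avg_iter)

text \<open>Records the choices for the indices k, ..., M - 1: an index in S shifts its left copy by
  -2, any other its right copy. Indices below k are still undecided.\<close>

definition branch_shift :: "nat \<Rightarrow> nat \<Rightarrow> nat set \<Rightarrow> nat + nat \<Rightarrow> real" where
  "branch_shift M k S = case_sum (\<lambda>i. if k \<le> i \<and> i < M \<and> i \<in> S then - 2 else 0)
     (\<lambda>i. if k \<le> i \<and> i < M \<and> i \<notin> S then - 2 else 0)"

text \<open>Downward induction on k: the outermost operator of \<open>avg_iter H (Suc k)\<close> is
  stripped off and its mean replaced by one of the two branches, so the last index is decided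
  first.\<close>

lemma select_branches:
  assumes H: "multiaffine H" "stable H" "eventually_positive H"
    and pos: "\<And>x. x \<ge> \<beta> \<Longrightarrow> Re (avg_iter H M (\<lambda>_. of_real x)) > 0"
  shows "\<exists>S. \<forall>x\<ge>\<beta>. Re (H (\<lambda>l. of_real x + of_real (branch_shift M 0 S l))) > 0"
proof -
  have "\<exists>S. \<forall>x\<ge>\<beta>. Re (avg_iter H k (\<lambda>l. of_real x + of_real (branch_shift M k S l))) > 0"
    if "k \<le> M" for k
    using that
  proof (induction k rule: inc_induct)
    case base
    have "branch_shift M M {} = (\<lambda>_. 0)" by (auto simp: branch_shift_def fun_eq_iff split: sum.split)
    then show ?case using pos by (intro exI[of _ "{}"]) simp
  next
    case (step k)
    define G where "G = avg_iter H k"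
    have G: "multiaffine G" "stable G" "eventually_positive G"
      unfolding G_def using H multiaffine_avg_iter stable_avg_iter eventually_positive_avg_iter by blast+
    from step obtain S where S: "\<And>x. x \<ge> \<beta> \<Longrightarrow>
        Re (avg_op k G (\<lambda>l. of_real x + of_real (branch_shift M (Suc k) S l))) > 0"
      by (auto simp: G_def)
    define s where "s = branch_shift M (Suc k) S"
    define F where "F z = G (\<lambda>l. z l + of_real (s l))" for z
    have F: "multiaffine F" "stable F"
      unfolding F_def[abs_def] by (intro multiaffine_shift stable_shift G)+
    have dF: "pderiv_at l F z = pderiv_at l G (\<lambda>l. z l + of_real (s l))" for l z
      unfolding F_def[abs_def] by (rule pderiv_at_shift)
    obtain X where X: "\<And>x. (\<And>k. X \<le> x k) \<Longrightarrow> Re (G (\<lambda>k. of_real (x k))) > 0"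
      using G(3) unfolding eventually_positive_def by blast
    have s: "s l \<ge> - 2" for l by (simp add: s_def branch_shift_def split: sum.split)
    have large: "Re (F (\<lambda>_. of_real x)) > 0" if "x \<ge> X + 2" for x
    proof -
      have "X \<le> x + s l" for l using s[of l] that by linarith
      then show ?thesis using X[of "\<lambda>l. x + s l"] by (simp add: F_def)
    qed
    have "\<exists>l\<in>{Inl k, Inr k}. \<forall>x\<ge>\<beta>. Re (F (\<lambda>_. of_real x) - 2 * pderiv_at l F (\<lambda>_. of_real x)) > 0"
    proof (rule select_branch[OF F large])
      fix x assume "x \<ge> \<beta>"
      from S[OF this] show "Re (F (\<lambda>_. of_real x) -
          (pderiv_at (Inl k) F (\<lambda>_. of_real x) + pderiv_at (Inr k) F (\<lambda>_. of_real x))) > 0"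
        unfolding dF by (simp add: avg_op_def pair_deriv_def F_def s_def)
    qed
    then obtain l where l: "l = Inl k \<or> l = Inr k"
      "\<And>x. x \<ge> \<beta> \<Longrightarrow> Re (F (\<lambda>_. of_real x) - 2 * pderiv_at l F (\<lambda>_. of_real x)) > 0"
      by auto
    define S' where "S' = (if l = Inl k then insert k S else S - {k})"
    have shift: "(\<lambda>j. ((\<lambda>_. of_real x)(l := of_real x - 2)) j + of_real (s j)) =
        (\<lambda>j. complex_of_real x + of_real (branch_shift M k S' j))" for x
    proof
      fix j
      have "k < M" using step.hyps by simp
      then have "s j + (if j = l then - 2 else 0) = branch_shift M k S' j"
        using l(1) by (cases j) (auto simp: s_def branch_shift_def S'_def)
      then have "complex_of_real (branch_shift M k S' j) = of_real (s j + (if j = l then - 2 else 0))"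
        by (simp only:)
      also have "\<dots> = of_real (s j) + (if j = l then - 2 else 0)" by simp
      finally show "((\<lambda>_. of_real x)(l := of_real x - 2)) j + of_real (s j) =
          complex_of_real x + of_real (branch_shift M k S' j)" by simp
    qed
    have "Re (G (\<lambda>j. of_real x + of_real (branch_shift M k S' j))) > 0" if "x \<ge> \<beta>" for x
    proof -
      \<comment> \<open>By affinity, subtracting twice the derivative is the shift of variable l by
        -2, which is the chosen branch.\<close>
      have "F ((\<lambda>_. of_real x)(l := of_real x + (- 2))) =
          F (\<lambda>_. of_real x) + (- 2) * pderiv_at l F (\<lambda>_. of_real x)"
        by (rule multiaffine_update[OF F(1), of "\<lambda>_. of_real x" l "- 2"])
      then have "Re (F ((\<lambda>_. of_real x)(l := of_real x - 2))) > 0" using l(2)[OF that] by simp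
      then show ?thesis unfolding F_def shift .
    qed
    then show ?case unfolding G_def by blast
  qed
  from this[of 0] show ?thesis by simp
qed

section \<open>The square in separated variables and the partition it yields\<close>

definition square :: "((nat \<Rightarrow> complex) \<Rightarrow> complex) \<Rightarrow> (nat + nat \<Rightarrow> complex) \<Rightarrow> complex" where
  "square q z = q (\<lambda>i. z (Inl i)) * q (\<lambda>i. z (Inr i))"

lemma square_update:
  "square q (z(Inl i := t)) = q ((\<lambda>i. z (Inl i))(i := t)) * q (\<lambda>i. z (Inr i))"
  "square q (z(Inr i := t)) = q (\<lambda>i. z (Inl i)) * q ((\<lambda>i. z (Inr i))(i := t))"
proof -
  have "(\<lambda>k. (z(Inl i := t)) (Inl k)) = (\<lambda>i. z (Inl i))(i := t)"
    "(\<lambda>k. (z(Inr i := t)) (Inr k)) = (\<lambda>i. z (Inr i))(i := t)" by auto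
  then show "square q (z(Inl i := t)) = q ((\<lambda>i. z (Inl i))(i := t)) * q (\<lambda>i. z (Inr i))"
    "square q (z(Inr i := t)) = q (\<lambda>i. z (Inl i)) * q ((\<lambda>i. z (Inr i))(i := t))"
    by (simp_all add: square_def)
qed

lemma multiaffine_square:
  assumes q: "multiaffine q"
  shows "multiaffine (square q)"
proof (rule multiaffineI)
  fix z :: "nat + nat \<Rightarrow> complex" and i t
  let ?l = "\<lambda>i. z (Inl i)" and ?r = "\<lambda>i. z (Inr i)"
  show "square q (z(i := z i + t)) = square q z + t * (square q (z(i := z i + 1)) - square q z)"
  proof (cases i)
    case (Inl k)
    have "q (?l(k := ?l k + t)) = q ?l + t * (q (?l(k := ?l k + 1)) - q ?l)"
      using multiaffine_update[OF q, of ?l k t] by (simp add: pderiv_at_def)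
    then have "q (?l(k := ?l k + t)) * q ?r = q ?l * q ?r + t * (q (?l(k := ?l k + 1)) * q ?r - q ?l * q ?r)"
      by (simp only: ring_distribs mult_ac)
    then show ?thesis unfolding Inl square_update by (simp only: square_def)
  next
    case (Inr k)
    have "q (?r(k := ?r k + t)) = q ?r + t * (q (?r(k := ?r k + 1)) - q ?r)"
      using multiaffine_update[OF q, of ?r k t] by (simp add: pderiv_at_def)
    then have "q ?l * q (?r(k := ?r k + t)) = q ?l * q ?r + t * (q ?l * q (?r(k := ?r k + 1)) - q ?l * q ?r)"
      by (simp only: ring_distribs mult_ac)
    then show ?thesis unfolding Inr square_update by (simp only: square_def)
  qed
next
  fix z :: "nat + nat \<Rightarrow> complex"
  show "square q (\<lambda>i. cnj (z i)) = cnj (square q z)"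
    using multiaffine_cnj[OF q, of "\<lambda>i. z (Inl i)"] multiaffine_cnj[OF q, of "\<lambda>i. z (Inr i)"]
    by (simp add: square_def)
next
  fix z d :: "nat + nat \<Rightarrow> complex"
  show "(\<lambda>t. square q (\<lambda>i. z i + t * d i)) holomorphic_on UNIV"
    unfolding square_def by (intro holomorphic_on_mult multiaffine_holomorphic q)
qed

lemma stable_square: "stable q \<Longrightarrow> stable (square q)"
  unfolding stable_def square_def by simp

text \<open>A sign change would give a zero on the segment from x to y, which stays in the open
  positive orthant.\<close>

lemma multiaffine_nonzero_same_sign:
  assumes q: "multiaffine q" and nz: "\<And>x. (\<And>i. x i > 0) \<Longrightarrow> q (\<lambda>i. of_real (x i)) \<noteq> 0"
    and x: "\<And>i. x i > 0" and y: "\<And>i. y i > 0"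
  shows "Re (q (\<lambda>i. of_real (x i))) * Re (q (\<lambda>i. of_real (y i))) > 0"
proof (rule ccontr)
  assume *: "\<not> ?thesis"
  define w where "w s = (\<lambda>i. x i + s * (y i - x i))" for s :: real
  define g where "g s = Re (q (\<lambda>i. of_real (w s i)))" for s
  have gnz: "g s \<noteq> 0" if "0 \<le> s" "s \<le> 1" for s
  proof -
    have "w s i > 0" for i
    proof -
      have "w s i = (1 - s) * x i + s * y i" by (simp add: w_def algebra_simps)
      moreover have "(1 - s) * x i \<ge> 0" "s * y i \<ge> 0" using that x[of i] y[of i] by auto
      moreover have "(1 - s) * x i > 0 \<or> s * y i > 0"
        using that x[of i] y[of i] by (cases "s = 0") auto
      ultimately show ?thesis by linarith
    qed
    from nz[of "w s", OF this] show ?thesis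
      using multiaffine_real[OF q, of "w s"] by (metis g_def of_real_0)
  qed
  have "continuous_on UNIV (\<lambda>t. q (\<lambda>i. of_real (x i) + t * of_real (y i - x i)))"
    by (rule holomorphic_on_imp_continuous_on[OF multiaffine_holomorphic[OF q]])
  from continuous_on_compose2[OF this, of UNIV of_real]
  have "continuous_on UNIV g" unfolding g_def w_def
    by (intro continuous_on_Re) (simp add: continuous_on_of_real_id)
  then have cont: "continuous_on {0..1} g" by (rule continuous_on_subset) simp
  have "g 0 * g 1 \<le> 0" using * by (simp add: g_def w_def)
  then have "(g 0 \<le> 0 \<and> 0 \<le> g 1) \<or> (g 1 \<le> 0 \<and> 0 \<le> g 0)" by (auto simp: mult_le_0_iff)
  then obtain s where "0 \<le> s" "s \<le> 1" "g s = 0"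
    using IVT'[of g 0 0 1] IVT2'[of g 1 0 0] cont by auto
  then show False using gnz by blast
qed

lemma barrier_partition:
  fixes q :: "(nat \<Rightarrow> complex) \<Rightarrow> complex"
  assumes q: "multiaffine q" "stable q"
    and dep: "\<And>z z'. (\<And>i. i < M \<Longrightarrow> z i = z' i) \<Longrightarrow> q z = q z'"
    and nz: "\<And>x. (\<And>i. x i > 0) \<Longrightarrow> q (\<lambda>i. of_real (x i)) \<noteq> 0"
    and \<epsilon>: "\<epsilon> > 0"
    and bound: "\<And>i t. i < M \<Longrightarrow> t > 0 \<Longrightarrow>
      Re (pderiv_at i q (\<lambda>_. of_real t)) / Re (q (\<lambda>_. of_real t)) \<le> \<epsilon> / t"
  shows "\<exists>S. \<forall>x\<ge>(1 + sqrt (2 * \<epsilon>))\<^sup>2.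
    q (\<lambda>i. of_real (if i \<in> S then x - 2 else x)) \<noteq> 0 \<and>
    q (\<lambda>i. of_real (if i \<in> S then x else x - 2)) \<noteq> 0"
proof -
  define r where "r = sqrt (2 * \<epsilon>)"
  have r: "r > 0" "2 * \<epsilon> = r * r" using \<epsilon> by (simp_all add: r_def)
  let ?H = "square q"
  have H: "multiaffine ?H" "stable ?H"
    using q by (simp_all add: multiaffine_square stable_square)
  have depH: "depends_below M ?H"
    unfolding depends_below_def square_def by (intro allI impI arg_cong2[where f = "(*)"] dep) auto
  have "Re (?H (\<lambda>k. of_real (x k))) > 0" if "\<forall>k. 1 \<le> x k" for x
  proof -
    have x: "x k > 0" for k using that[rule_format, of k] by linarith
    have "?H (\<lambda>k. of_real (x k)) =
        of_real (Re (q (\<lambda>i. of_real (x (Inl i))))) * of_real (Re (q (\<lambda>i. of_real (x (Inr i)))))"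
      unfolding square_def using multiaffine_real[OF q(1)] by metis
    also have "Re \<dots> > 0"
      using multiaffine_nonzero_same_sign[OF q(1) nz, of "\<lambda>i. x (Inl i)" "\<lambda>i. x (Inr i)"] x by simp
    finally show ?thesis .
  qed
  then have evH: "eventually_positive ?H" unfolding eventually_positive_def by blast
  have dvalH: "dval ?H x = (Re (q (\<lambda>i. of_real (x i))))\<^sup>2" for x
  proof -
    have "?H (\<lambda>k. of_real (diag x k)) = q (\<lambda>i. of_real (x i)) * q (\<lambda>i. of_real (x i))"
      by (simp add: square_def)
    also have "\<dots> = of_real (Re (q (\<lambda>i. of_real (x i)))) * of_real (Re (q (\<lambda>i. of_real (x i))))"
      using multiaffine_real[OF q(1), of x] by simp
    finally show ?thesis by (simp add: dval_def power2_eq_square)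
  qed
  \<comment> \<open>The barrier of the square at t is at most 2 \<epsilon> / t = r^2 / t and has to
    be at most 1 - 1 / \<delta>, where \<delta> is the later shift of the barrier point. Under this
    constraint t = r + r^2 and \<delta> = 1 + r minimise t + \<delta>, with value (1 + r)^2.\<close>
  define t where "t = r + r * r"
  have t: "t > 0" using r by (simp add: t_def add_pos_pos)
  have posH: "positive_above M ?H (\<lambda>_. t)"
    unfolding positive_above_def
  proof (intro allI impI)
    fix x :: "nat \<Rightarrow> real" assume x: "\<forall>i<M. t \<le> x i"
    \<comment> \<open>Coordinates from M on may be negative in x; the value 1 makes
      \<open>nz\<close> applicable without changing q.\<close>
    let ?y = "\<lambda>i. if i < M then x i else 1"
    have "?y i > 0" for i using x t by (auto intro: less_le_trans)
    from nz[of ?y, OF this] have "q (\<lambda>i. of_real (x i)) \<noteq> 0"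
      using dep[of "\<lambda>i. of_real (x i)" "\<lambda>i. of_real (?y i)"] by simp
    then have "Re (q (\<lambda>i. of_real (x i))) \<noteq> 0"
      using multiaffine_real[OF q(1), of x] by (metis of_real_0)
    then show "dval ?H x > 0" by (simp add: dvalH)
  qed
  have boundH: "dval (pair_deriv i ?H) (\<lambda>_. t) / dval ?H (\<lambda>_. t) \<le> 1 - 1 / (1 + r)" if "i < M" for i
  proof -
    let ?t = "\<lambda>_ :: nat. complex_of_real t"
    have nzt: "Re (q ?t) \<noteq> 0"
      using nz[of "\<lambda>_. t"] t multiaffine_real[OF q(1), of "\<lambda>_. t"] by (metis of_real_0)
    have "pair_deriv i ?H (\<lambda>k. of_real (diag (\<lambda>_. t) k)) = 2 * (q ?t * pderiv_at i q ?t)"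
      unfolding pair_deriv_def pderiv_at_def square_update by (simp add: square_def algebra_simps)
    also have "\<dots> = of_real (2 * (Re (q ?t) * Re (pderiv_at i q ?t)))"
      using multiaffine_real[OF q(1), of "\<lambda>_. t"]
        multiaffine_real[OF multiaffine_pderiv_at[OF q(1)], of i "\<lambda>_. t"] by simp
    finally have "dval (pair_deriv i ?H) (\<lambda>_. t) = 2 * (Re (q ?t) * Re (pderiv_at i q ?t))"
      by (simp add: dval_def)
    then have "dval (pair_deriv i ?H) (\<lambda>_. t) / dval ?H (\<lambda>_. t) = 2 * (Re (pderiv_at i q ?t) / Re (q ?t))"
      using nzt by (simp add: dvalH power2_eq_square)
    also have "\<dots> \<le> 2 * (\<epsilon> / t)" using bound[OF that t] by simp
    also have "\<dots> = (r * r) / (r * (1 + r))" using r(2) by (simp add: t_def algebra_simps)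
    also have "\<dots> = r / (1 + r)" using r(1) by simp
    also have "\<dots> = 1 - 1 / (1 + r)" using r(1) by (simp add: diff_divide_distrib[symmetric] divide_simps)
    finally show ?thesis .
  qed
  have "positive_above M (avg_iter ?H M) (\<lambda>_. t + (1 + r))"
    using r by (intro avg_iter_positive_above[OF H depH posH _ boundH]) auto
  moreover have "t + (1 + r) = (1 + r)\<^sup>2" by (simp add: t_def power2_eq_square algebra_simps)
  ultimately have "Re (avg_iter ?H M (\<lambda>_. of_real x)) > 0" if "x \<ge> (1 + r)\<^sup>2" for x
    using that unfolding positive_above_def dval_def
    by (auto simp: diag_comp[of of_real] diag_def dest!: spec[of _ "\<lambda>_. x"] split: sum.splits)
  from select_branches[OF H evH this] obtain S where S: "\<And>x. x \<ge> (1 + r)\<^sup>2 \<Longrightarrow>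
      Re (?H (\<lambda>l. of_real x + of_real (branch_shift M 0 S l))) > 0" by blast
  have "q (\<lambda>i. of_real (if i \<in> S then x - 2 else x)) \<noteq> 0 \<and>
      q (\<lambda>i. of_real (if i \<in> S then x else x - 2)) \<noteq> 0" if "x \<ge> (1 + r)\<^sup>2" for x
  proof -
    have "q (\<lambda>i. of_real x + of_real (branch_shift M 0 S (Inl i))) =
        q (\<lambda>i. of_real (if i \<in> S then x - 2 else x))"
      by (rule dep) (auto simp: branch_shift_def)
    moreover have "q (\<lambda>i. of_real x + of_real (branch_shift M 0 S (Inr i))) =
        q (\<lambda>i. of_real (if i \<in> S then x else x - 2))"
      by (rule dep) (auto simp: branch_shift_def)
    ultimately show ?thesis using S[OF that] by (auto simp: square_def)
  qed
  then show ?thesis unfolding r_def by blast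
qed

section \<open>Determinants of frame matrices\<close>

text \<open>The updated matrix is the Schur complement of the corner 1 in the bordered matrix
  \<open>B t\<close>, and \<open>C t\<close> performs the elimination. In \<open>B t\<close> only
  the first column depends on t, and it does so affinely, so Laplace expansion along it gives the
  claim for singular A as well.\<close>

lemma det_rank_one_affine:
  fixes A :: "'a :: idom mat"
  assumes A: "A \<in> carrier_mat n n"
  shows "\<exists>c. \<forall>t. det (mat n n (\<lambda>(a, b). A $$ (a, b) + t * x a * y b)) = det A + t * c"
proof -
  define B where "B t = four_block_mat (1\<^sub>m 1) (mat 1 n (\<lambda>(a, b). y b))
    (mat n 1 (\<lambda>(a, b). - t * x a)) A" for t
  define C where "C t = four_block_mat (1\<^sub>m 1) (0\<^sub>m 1 n) (mat n 1 (\<lambda>(a, b). t * x a)) (1\<^sub>m n)" for t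
  have B: "B t \<in> carrier_mat (Suc n) (Suc n)" for t
    using four_block_carrier_mat[of "1\<^sub>m 1" 1 1 A n n] A unfolding B_def by simp
  have C: "C t \<in> carrier_mat (Suc n) (Suc n)" for t
    using four_block_carrier_mat[of "1\<^sub>m 1" 1 1 "1\<^sub>m n" n n] unfolding C_def by simp
  have "C t * B t = four_block_mat (1\<^sub>m 1) (mat 1 n (\<lambda>(a, b). y b)) (0\<^sub>m n 1)
      (mat n n (\<lambda>(a, b). A $$ (a, b) + t * x a * y b))" for t
    unfolding B_def C_def
    by (subst mult_four_block_mat[of _ 1 1 _ n _ n _ _ 1 _ n], use A in simp_all)
       (rule cong_four_block_mat; use A in \<open>auto simp: scalar_prod_def\<close>)
  then have "det (C t * B t) = det (1\<^sub>m 1) * det (mat n n (\<lambda>(a, b). A $$ (a, b) + t * x a * y b))" for t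
    using det_four_block_mat_lower_left_zero[of "1\<^sub>m 1" 1 "mat 1 n (\<lambda>(a, b). y b)" n "0\<^sub>m n 1"
      "mat n n (\<lambda>(a, b). A $$ (a, b) + t * x a * y b)"] by simp
  moreover have "det (C t) = 1" for t
    unfolding C_def by (subst det_four_block_mat_upper_right_zero[of _ 1 _ n]) auto
  ultimately have det: "det (mat n n (\<lambda>(a, b). A $$ (a, b) + t * x a * y b)) = det (B t)" for t
    using det_mult[OF C B, of t t] by simp
  have cof: "cofactor (B t) i 0 = cofactor (B 0) i 0" if "i < Suc n" for i t
  proof -
    have "mat_delete (B t) i 0 = mat_delete (B 0) i 0"
      using that A by (intro eq_matI) (auto simp: mat_delete_def B_def)
    then show ?thesis by (simp only: cofactor_def)
  qed
  have "det (B t) = cofactor (B 0) 0 0 + t * - (\<Sum>i<n. x i * cofactor (B 0) (Suc i) 0)" for t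
  proof -
    have "det (B t) = (\<Sum>i<Suc n. B t $$ (i, 0) * cofactor (B t) i 0)"
      by (rule laplace_expansion_column[OF B]) simp
    also have "\<dots> = (\<Sum>i<Suc n. B t $$ (i, 0) * cofactor (B 0) i 0)"
      by (intro sum.cong refl arg_cong2[where f = "(*)"] cof) auto
    also have "\<dots> = B t $$ (0, 0) * cofactor (B 0) 0 0 +
        (\<Sum>i<n. B t $$ (Suc i, 0) * cofactor (B 0) (Suc i) 0)"
      by (rule sum.lessThan_Suc_shift)
    also have "(\<Sum>i<n. B t $$ (Suc i, 0) * cofactor (B 0) (Suc i) 0) =
        (\<Sum>i<n. - (t * (x i * cofactor (B 0) (Suc i) 0)))"
      using A by (intro sum.cong refl) (simp add: B_def)
    also have "B t $$ (0, 0) = 1" using A by (simp add: B_def)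
    finally show ?thesis by (simp add: sum_distrib_left sum_negf)
  qed
  note B_eq = this
  have "mat n n (\<lambda>(a, b). A $$ (a, b) + 0 * x a * y b) = A" using A by (intro eq_matI) auto
  then have "det A = cofactor (B 0) 0 0" using det[of 0] B_eq[of 0] by simp
  then show ?thesis
    unfolding det B_eq by (intro exI[of _ "- (\<Sum>i<n. x i * cofactor (B 0) (Suc i) 0)"]) simp
qed

text \<open>The weighted frame operator
  \<open>\<Sum>\<^sub>i z\<^sub>i v\<^sub>i v\<^sub>i\<^sup>*\<close>.\<close>

definition frame_mat :: "nat \<Rightarrow> nat \<Rightarrow> (nat \<Rightarrow> complex vec) \<Rightarrow> (nat \<Rightarrow> complex) \<Rightarrow> complex mat" where
  "frame_mat N M v z = mat N N (\<lambda>(a, b). \<Sum>i<M. z i * vec_index (v i) a * cnj (vec_index (v i) b))"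

lemma frame_mat_carrier [simp]: "frame_mat N M v z \<in> carrier_mat N N"
  by (simp add: frame_mat_def)

lemma frame_mat_cong: "(\<And>i. i < M \<Longrightarrow> z i = z' i) \<Longrightarrow> frame_mat N M v z = frame_mat N M v z'"
  unfolding frame_mat_def by (intro eq_matI) auto

lemma cscalar_prod_eq:
  "v \<in> carrier_vec N \<Longrightarrow> w \<bullet>c v = (\<Sum>b<N. vec_index w b * cnj (vec_index v b))" for v w :: "complex vec"
  by (simp add: scalar_prod_def lessThan_atLeast0)

lemma frame_mat_cscalar_prod:
  assumes v: "\<And>i. i < M \<Longrightarrow> v i \<in> carrier_vec N"
    and w: "w \<in> carrier_vec N" and u: "u \<in> carrier_vec N"
  shows "(frame_mat N M v z *\<^sub>v w) \<bullet>c u = (\<Sum>i<M. z i * (w \<bullet>c v i) * cnj (u \<bullet>c v i))"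
proof -
  have "vec_index (frame_mat N M v z *\<^sub>v w) a = (\<Sum>i<M. z i * (w \<bullet>c v i) * vec_index (v i) a)"
    if a: "a < N" for a
  proof -
    have "vec_index (frame_mat N M v z *\<^sub>v w) a =
        (\<Sum>b<N. (\<Sum>i<M. z i * vec_index (v i) a * cnj (vec_index (v i) b)) * vec_index w b)"
      using a w by (simp add: frame_mat_def mult_mat_vec_def scalar_prod_def lessThan_atLeast0)
    also have "\<dots> = (\<Sum>i<M. \<Sum>b<N. z i * vec_index (v i) a * cnj (vec_index (v i) b) * vec_index w b)"
      unfolding sum_distrib_right by (rule sum.swap)
    also have "\<dots> = (\<Sum>i<M. z i * (w \<bullet>c v i) * vec_index (v i) a)"
      by (intro sum.cong refl)
        (simp add: cscalar_prod_eq[OF v] sum_distrib_left sum_distrib_right mult_ac)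
    finally show ?thesis .
  qed
  then have "(frame_mat N M v z *\<^sub>v w) \<bullet>c u =
      (\<Sum>a<N. (\<Sum>i<M. z i * (w \<bullet>c v i) * vec_index (v i) a) * cnj (vec_index u a))"
    by (simp add: cscalar_prod_eq[OF u])
  also have "\<dots> = (\<Sum>i<M. \<Sum>a<N. z i * (w \<bullet>c v i) * vec_index (v i) a * cnj (vec_index u a))"
    unfolding sum_distrib_right by (rule sum.swap)
  also have "\<dots> = (\<Sum>i<M. z i * (w \<bullet>c v i) * cnj (u \<bullet>c v i))"
    by (intro sum.cong refl) (simp add: cscalar_prod_eq[OF v, where w = u] sum_distrib_left mult_ac)
  finally show ?thesis .
qed

lemma frame_mat_form:
  assumes v: "\<And>i. i < M \<Longrightarrow> v i \<in> carrier_vec N" and w: "w \<in> carrier_vec N"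
  shows "(frame_mat N M v z *\<^sub>v w) \<bullet>c w = (\<Sum>i<M. z i * of_real ((cmod (w \<bullet>c v i))\<^sup>2))"
proof -
  have "(frame_mat N M v z *\<^sub>v w) \<bullet>c w = (\<Sum>i<M. z i * (w \<bullet>c v i) * cnj (w \<bullet>c v i))"
    using v w by (intro frame_mat_cscalar_prod)
  also have "\<dots> = (\<Sum>i<M. z i * of_real ((cmod (w \<bullet>c v i))\<^sup>2))"
    by (intro sum.cong refl) (simp only: mult.assoc complex_norm_square)
  finally show ?thesis .
qed

text \<open>Changing one weight is a rank-one update, hence affine. Conjugating the weights gives
  the conjugate transpose, and the Leibniz formula gives holomorphy.\<close>

lemma frame_det_multiaffine: "multiaffine (\<lambda>z. det (frame_mat N M v z))"
proof (rule multiaffineI)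
  fix z :: "nat \<Rightarrow> complex" and i t
  show "det (frame_mat N M v (z(i := z i + t))) = det (frame_mat N M v z) +
      t * (det (frame_mat N M v (z(i := z i + 1))) - det (frame_mat N M v z))"
  proof (cases "i < M")
    case False
    then have "frame_mat N M v (z(i := s)) = frame_mat N M v z" for s
      by (intro frame_mat_cong) auto
    then show ?thesis by simp
  next
    case True
    have upd: "frame_mat N M v (z(i := z i + s)) = mat N N (\<lambda>(a, b). frame_mat N M v z $$ (a, b) +
        s * vec_index (v i) a * cnj (vec_index (v i) b))" for s
    proof (rule eq_matI)
      fix a b assume "a < dim_row (mat N N (\<lambda>(a, b). frame_mat N M v z $$ (a, b) +
        s * vec_index (v i) a * cnj (vec_index (v i) b)))" "b < dim_col (mat N N (\<lambda>(a, b). frame_mat N M v z $$ (a, b) +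
        s * vec_index (v i) a * cnj (vec_index (v i) b)))"
      then have ab: "a < N" "b < N" by simp_all
      have "(\<Sum>k<M. (z(i := z i + s)) k * vec_index (v k) a * cnj (vec_index (v k) b)) =
          (\<Sum>k<M. z k * vec_index (v k) a * cnj (vec_index (v k) b) +
            (if k = i then s * vec_index (v i) a * cnj (vec_index (v i) b) else 0))"
        by (intro sum.cong refl) (auto simp: algebra_simps)
      also have "\<dots> = (\<Sum>k<M. z k * vec_index (v k) a * cnj (vec_index (v k) b)) +
          s * vec_index (v i) a * cnj (vec_index (v i) b)"
        using True by (simp add: sum.distrib)
      finally show "frame_mat N M v (z(i := z i + s)) $$ (a, b) = mat N N (\<lambda>(a, b). frame_mat N M v z $$ (a, b) +
        s * vec_index (v i) a * cnj (vec_index (v i) b)) $$ (a, b)"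
        using ab by (simp add: frame_mat_def)
    qed (simp_all add: frame_mat_def)
    obtain c where c: "\<And>s. det (frame_mat N M v (z(i := z i + s))) = det (frame_mat N M v z) + s * c"
      unfolding upd using det_rank_one_affine[OF frame_mat_carrier[of N M v z],
          where x = "\<lambda>a. vec_index (v i) a" and y = "\<lambda>b. cnj (vec_index (v i) b)"] by blast
    show ?thesis unfolding c[of t] c[of 1] by simp
  qed
next
  fix z :: "nat \<Rightarrow> complex"
  interpret cnj: comm_ring_hom cnj by unfold_locales auto
  have "frame_mat N M v (\<lambda>i. cnj (z i)) = transpose_mat (map_mat cnj (frame_mat N M v z))"
    by (intro eq_matI) (auto simp: frame_mat_def mult_ac)
  then have "det (frame_mat N M v (\<lambda>i. cnj (z i))) = det (map_mat cnj (frame_mat N M v z))"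
    by (simp add: det_transpose[of _ N])
  also have "\<dots> = cnj (det (frame_mat N M v z))" by (rule cnj.hom_det)
  finally show "det (frame_mat N M v (\<lambda>i. cnj (z i))) = cnj (det (frame_mat N M v z))" .
next
  fix z d :: "nat \<Rightarrow> complex"
  have "(\<lambda>t. frame_mat N M v (\<lambda>i. z i + t * d i) $$ (a, p a)) holomorphic_on UNIV"
    if "a < N" "p permutes {0..<N}" for a p
  proof -
    have "p a < N" using that permutes_in_image[of p "{0..<N}" a] by simp
    then show ?thesis using that(1) by (simp add: frame_mat_def) (intro holomorphic_intros)
  qed
  then show "(\<lambda>t. det (frame_mat N M v (\<lambda>i. z i + t * d i))) holomorphic_on UNIV"
    unfolding det_def'[OF frame_mat_carrier]
    by (intro holomorphic_on_sum holomorphic_on_mult holomorphic_on_const holomorphic_on_prod) auto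
qed

section \<open>The two-block partition theorem\<close>

definition frame_sum :: "(nat \<Rightarrow> complex vec) \<Rightarrow> nat set \<Rightarrow> complex vec \<Rightarrow> real" where
  "frame_sum v J w = (\<Sum>j\<in>J. (cmod (w \<bullet>c v j))\<^sup>2)"

lemma frame_sum_nonneg: "frame_sum v J w \<ge> 0"
  unfolding frame_sum_def by (intro sum_nonneg) auto

text \<open>A kernel vector w of the matrix A satisfies \<langle>A w, w\<rangle> = 0. This turns
  every statement about zeros of the determinant into one about a weighted sum of squares.\<close>

lemma det_frame_mat_zeroE:
  assumes v: "\<And>i. i < M \<Longrightarrow> v i \<in> carrier_vec N" and "det (frame_mat N M v z) = 0"
  obtains w where "w \<in> carrier_vec N" "w \<noteq> 0\<^sub>v N"
    "(\<Sum>i<M. z i * of_real ((cmod (w \<bullet>c v i))\<^sup>2)) = 0"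
proof -
  obtain w where w: "w \<in> carrier_vec N" "w \<noteq> 0\<^sub>v N" "frame_mat N M v z *\<^sub>v w = 0\<^sub>v N"
    using det_0_iff_vec_prod_zero[OF frame_mat_carrier] assms(2) by blast
  have "(\<Sum>i<M. z i * of_real ((cmod (w \<bullet>c v i))\<^sup>2)) = (frame_mat N M v z *\<^sub>v w) \<bullet>c w"
    using v w(1) by (intro frame_mat_form[symmetric])
  also have "\<dots> = 0" using w by simp
  finally show ?thesis using that w by blast
qed

text \<open>\<open>nondegenerate\<close> says that the frame operator is positive definite.\<close>

locale frame =
  fixes N M :: nat and v :: "nat \<Rightarrow> complex vec"
  assumes v: "\<And>i. i < M \<Longrightarrow> v i \<in> carrier_vec N"
    and nondegenerate: "\<And>w. w \<in> carrier_vec N \<Longrightarrow> w \<noteq> 0\<^sub>v N \<Longrightarrow> frame_sum v {..<M} w > 0"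
begin

definition form :: "(nat \<Rightarrow> real) \<Rightarrow> complex vec \<Rightarrow> real" where
  "form y w = (\<Sum>i<M. y i * (cmod (w \<bullet>c v i))\<^sup>2)"

text \<open>At a zero, the imaginary part of the degenerate form is a sum of squares with positive
  weights, so w would be orthogonal to all vectors of the frame.\<close>

lemma stable_det: "stable (\<lambda>z. det (frame_mat N M v z))"
  unfolding stable_def
proof (intro allI impI notI)
  fix z :: "nat \<Rightarrow> complex" assume z: "\<forall>i. Im (z i) > 0" and "det (frame_mat N M v z) = 0"
  then obtain w where w: "w \<in> carrier_vec N" "w \<noteq> 0\<^sub>v N"
    "(\<Sum>i<M. z i * of_real ((cmod (w \<bullet>c v i))\<^sup>2)) = 0"
    using det_frame_mat_zeroE[of M v N z] v by blast
  have "(\<Sum>i<M. Im (z i) * (cmod (w \<bullet>c v i))\<^sup>2) = Im (\<Sum>i<M. z i * of_real ((cmod (w \<bullet>c v i))\<^sup>2))"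
    by simp
  also have "\<dots> = 0" unfolding w(3) by simp
  finally have "\<forall>i<M. Im (z i) * (cmod (w \<bullet>c v i))\<^sup>2 = 0"
    using z by (subst (asm) sum_nonneg_eq_0_iff) (auto intro!: mult_nonneg_nonneg simp: less_imp_le)
  then have "frame_sum v {..<M} w = 0"
    unfolding frame_sum_def using z by (intro sum.neutral) (auto simp: less_le)
  then show False using nondegenerate[OF w(1,2)] by simp
qed

lemma det_nonzero_pos:
  assumes x: "\<And>i. x i > 0"
  shows "det (frame_mat N M v (\<lambda>i. of_real (x i))) \<noteq> 0"
proof
  assume "det (frame_mat N M v (\<lambda>i. of_real (x i))) = 0"
  then obtain w where w: "w \<in> carrier_vec N" "w \<noteq> 0\<^sub>v N"
    "(\<Sum>i<M. complex_of_real (x i) * of_real ((cmod (w \<bullet>c v i))\<^sup>2)) = 0"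
    using det_frame_mat_zeroE[of M v N "\<lambda>i. of_real (x i)"] v by blast
  then have "complex_of_real (\<Sum>i<M. x i * (cmod (w \<bullet>c v i))\<^sup>2) = 0" by simp
  then have "(\<Sum>i<M. x i * (cmod (w \<bullet>c v i))\<^sup>2) = 0" by (simp only: of_real_eq_0_iff)
  then have "\<forall>i<M. x i * (cmod (w \<bullet>c v i))\<^sup>2 = 0"
    using x by (subst (asm) sum_nonneg_eq_0_iff) (auto intro!: mult_nonneg_nonneg simp: less_imp_le)
  then have "frame_sum v {..<M} w = 0"
    unfolding frame_sum_def using x by (intro sum.neutral) (auto simp: less_le)
  then show False using nondegenerate[OF w(1,2)] by simp
qed

text \<open>The logarithmic derivative of an affine function is read off its root: \<open>s\<close> is the value
  for which \<open>\<Sum>\<^sub>k t |\<langle>w, v\<^sub>k\<rangle>|\<^sup>2 + s |\<langle>w, v\<^sub>i\<rangle>|\<^sup>2\<close> degenerates.\<close>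

lemma log_deriv_det_le:
  assumes i: "i < M" and t: "t > 0" and \<epsilon>: "\<epsilon> > 0"
    and lev: "\<And>w. w \<in> carrier_vec N \<Longrightarrow> (cmod (w \<bullet>c v i))\<^sup>2 \<le> \<epsilon> * frame_sum v {..<M} w"
  defines "q \<equiv> \<lambda>z. det (frame_mat N M v z)"
  shows "Re (pderiv_at i q (\<lambda>_. of_real t)) / Re (q (\<lambda>_. of_real t)) \<le> \<epsilon> / t"
proof -
  have q: "multiaffine q" unfolding q_def by (rule frame_det_multiaffine)
  define a where "a = Re (q (\<lambda>_. of_real t))"
  define b where "b = Re (pderiv_at i q (\<lambda>_. of_real t))"
  have a: "q (\<lambda>_. of_real t) = of_real a"
    unfolding a_def by (rule multiaffine_real[OF q, of "\<lambda>_. t"])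
  have b: "pderiv_at i q (\<lambda>_. of_real t) = of_real b"
    unfolding b_def by (rule multiaffine_real[OF multiaffine_pderiv_at[OF q], of i "\<lambda>_. t"])
  have "a \<noteq> 0" using det_nonzero_pos[of "\<lambda>_. t"] t a unfolding q_def by auto
  show ?thesis
  proof (cases "b = 0")
    case True
    then show ?thesis using t \<epsilon> by (simp flip: a_def b_def)
  next
    case False
    define s where "s = - a / b"
    define y where "y = (\<lambda>_. complex_of_real t)(i := of_real t + of_real s)"
    have "q y = 0"
      unfolding y_def multiaffine_update[OF q, of "\<lambda>_. of_real t" i "of_real s"] a b
      using False by (simp add: s_def)
    then obtain w where w: "w \<in> carrier_vec N" "w \<noteq> 0\<^sub>v N"
      "(\<Sum>k<M. y k * of_real ((cmod (w \<bullet>c v k))\<^sup>2)) = 0"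
      unfolding q_def using det_frame_mat_zeroE[of M v N y] v by blast
    have "(\<Sum>k<M. y k * of_real ((cmod (w \<bullet>c v k))\<^sup>2)) =
        of_real (\<Sum>k<M. t * (cmod (w \<bullet>c v k))\<^sup>2 + (if k = i then s * (cmod (w \<bullet>c v i))\<^sup>2 else 0))"
      unfolding of_real_sum y_def by (intro sum.cong refl) (auto simp: algebra_simps)
    with w(3) have "(\<Sum>k<M. t * (cmod (w \<bullet>c v k))\<^sup>2 + (if k = i then s * (cmod (w \<bullet>c v i))\<^sup>2 else 0)) = 0"
      by (simp only: of_real_eq_0_iff)
    then have eq: "t * frame_sum v {..<M} w + s * (cmod (w \<bullet>c v i))\<^sup>2 = 0"
      using i by (simp add: sum.distrib frame_sum_def sum_distrib_left)
    define B where "B = frame_sum v {..<M} w"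
    have B: "B > 0" unfolding B_def by (rule nondegenerate[OF w(1,2)])
    have "t * B + s * (cmod (w \<bullet>c v i))\<^sup>2 = 0" using eq by (simp only: B_def)
    then have s: "s < 0" using t B
      by (metis add_pos_nonneg less_irrefl mult_nonneg_nonneg mult_pos_pos not_less zero_le_power2)
    have "- s * (cmod (w \<bullet>c v i))\<^sup>2 \<le> - s * (\<epsilon> * B)"
      using lev[OF w(1)] s unfolding B_def by (intro mult_left_mono) auto
    then have "t * B \<le> (- s * \<epsilon>) * B" using \<open>t * B + s * (cmod (w \<bullet>c v i))\<^sup>2 = 0\<close> by simp
    then have "t \<le> - s * \<epsilon>" using B by (rule mult_right_le_imp_le)
    then have "1 / (- s) \<le> \<epsilon> / t" using s t by (simp add: field_simps)
    moreover have "b / a = 1 / (- s)" using False \<open>a \<noteq> 0\<close> by (simp add: s_def)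
    ultimately show ?thesis by (simp flip: a_def b_def)
  qed
qed

section \<open>From nonvanishing determinants to semidefinite forms\<close>

lemma form_shift: "form (\<lambda>i. y i + s) w = form y w + s * frame_sum v {..<M} w"
  unfolding form_def frame_sum_def by (simp add: distrib_right sum.distrib sum_distrib_left)

text \<open>Cauchy--Schwarz for the positive semidefinite form \<open>A = form y\<close>: writing \<open>v\<^sub>i = A u\<close> gives
  \<open>|\<langle>w, v\<^sub>i\<rangle>|\<^sup>2 = |\<langle>A w, u\<rangle>|\<^sup>2 \<le> (1 + A(u, u)) A(w, w)\<close>.\<close>

lemma cmod_sq_le_form:
  assumes det: "det (frame_mat N M v (\<lambda>i. of_real (y i))) \<noteq> 0"
    and psd: "\<And>w. w \<in> carrier_vec N \<Longrightarrow> form y w \<ge> 0" and i: "i < M"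
  shows "\<exists>L\<ge>0. \<forall>w\<in>carrier_vec N. (cmod (w \<bullet>c v i))\<^sup>2 \<le> L * form y w"
proof -
  let ?A = "frame_mat N M v (\<lambda>i. of_real (y i))"
  obtain B where B: "B \<in> carrier_mat N N" "?A * B = 1\<^sub>m N"
    using det_non_zero_imp_unit[OF frame_mat_carrier det] by (auto simp: Units_def ring_mat_def)
  define u where "u = B *\<^sub>v v i"
  have u: "u \<in> carrier_vec N" using B(1) v[OF i] by (simp add: u_def)
  have Au: "?A *\<^sub>v u = v i"
    unfolding u_def using B v[OF i] by (subst assoc_mult_mat_vec[symmetric, OF frame_mat_carrier]) auto
  \<comment> \<open>The minimising coefficient would be 1 / \<open>form y u\<close>; the added 1
    keeps the denominator positive.\<close>
  define \<tau> where "\<tau> = 1 / (1 + form y u)"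
  have \<tau>: "\<tau> > 0" "\<tau> * form y u \<le> 1" using psd[OF u] by (auto simp: \<tau>_def field_simps)
  have "(cmod (w \<bullet>c v i))\<^sup>2 \<le> (1 + form y u) * form y w" if w: "w \<in> carrier_vec N" for w
  proof -
    define c where "c = w \<bullet>c v i"
    have c: "c = (\<Sum>k<M. of_real (y k) * (w \<bullet>c v k) * cnj (u \<bullet>c v k))"
    proof -
      have "cnj c = v i \<bullet>c w"
        unfolding c_def using w v[OF i]
        by (simp add: cscalar_prod_eq mult_ac)
      also have "\<dots> = (?A *\<^sub>v u) \<bullet>c w" by (simp only: Au)
      also have "\<dots> = (\<Sum>k<M. of_real (y k) * (u \<bullet>c v k) * cnj (w \<bullet>c v k))"
        by (rule frame_mat_cscalar_prod[OF v u w])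
      finally have "cnj (cnj c) = cnj (\<Sum>k<M. of_real (y k) * (u \<bullet>c v k) * cnj (w \<bullet>c v k))" by simp
      then show ?thesis by (simp add: mult_ac)
    qed
    define l where "l = of_real \<tau> * c"
    \<comment> \<open>A damped projection of w along u; expanding \<open>form y x\<close> \<ge> 0
      gives the inequality.\<close>
    define x where "x = w - l \<cdot>\<^sub>v u"
    have x: "x \<in> carrier_vec N" using w u by (simp add: x_def)
    have xk: "x \<bullet>c v k = w \<bullet>c v k - l * (u \<bullet>c v k)" if "k < M" for k
      using w u v[OF that] unfolding x_def
      by (simp add: minus_scalar_prod_distrib[of _ N])
    have "(\<Sum>k<M. y k * (cmod (x \<bullet>c v k))\<^sup>2) = (\<Sum>k<M. y k * (cmod (w \<bullet>c v k))\<^sup>2 -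
        2 * Re (cnj l * (of_real (y k) * (w \<bullet>c v k) * cnj (u \<bullet>c v k))) +
        (cmod l)\<^sup>2 * (y k * (cmod (u \<bullet>c v k))\<^sup>2))"
    proof (intro sum.cong refl)
      fix k assume "k \<in> {..<M}"
      then have "x \<bullet>c v k = w \<bullet>c v k - l * (u \<bullet>c v k)" using xk by simp
      then show "y k * (cmod (x \<bullet>c v k))\<^sup>2 = y k * (cmod (w \<bullet>c v k))\<^sup>2 -
        2 * Re (cnj l * (of_real (y k) * (w \<bullet>c v k) * cnj (u \<bullet>c v k))) +
        (cmod l)\<^sup>2 * (y k * (cmod (u \<bullet>c v k))\<^sup>2)"
        by (simp only: cmod_power2) (simp add: power2_eq_square algebra_simps)
    qed
    then have "form y x = form y w - 2 * Re (cnj l * c) + (cmod l)\<^sup>2 * form y u"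
      unfolding form_def c by (simp only: sum.distrib sum_subtractf sum_distrib_left[symmetric] Re_sum[symmetric])
    also have "Re (cnj l * c) = \<tau> * (cmod c)\<^sup>2"
      unfolding l_def by (simp add: cmod_power2) (simp add: power2_eq_square algebra_simps)
    also have "(cmod l)\<^sup>2 = \<tau> * (\<tau> * (cmod c)\<^sup>2)"
      using \<tau> by (simp add: l_def norm_mult power2_eq_square)
    finally have "0 \<le> form y w - 2 * (\<tau> * (cmod c)\<^sup>2) + \<tau> * (\<tau> * (cmod c)\<^sup>2) * form y u"
      using psd[OF x] by simp
    moreover have "\<tau> * (\<tau> * (cmod c)\<^sup>2) * form y u \<le> \<tau> * (cmod c)\<^sup>2"
      using mult_right_mono[OF \<tau>(2), of "\<tau> * (cmod c)\<^sup>2"] \<tau>(1) by (simp add: mult_ac)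
    ultimately have "\<tau> * (cmod c)\<^sup>2 \<le> form y w" by linarith
    then show ?thesis using psd[OF u] by (simp add: \<tau>_def c_def field_simps)
  qed
  then show ?thesis using psd[OF u] by (intro exI[of _ "1 + form y u"]) auto
qed

text \<open>A nonsingular semidefinite form is definite with a quantitative margin relative to the
  frame operator. Summing the bounds for the single vectors yields the constant without eigenvalues
  or compactness.\<close>

lemma frame_sum_le_form:
  assumes det: "det (frame_mat N M v (\<lambda>i. of_real (y i))) \<noteq> 0"
    and psd: "\<And>w. w \<in> carrier_vec N \<Longrightarrow> form y w \<ge> 0"
  shows "\<exists>L\<ge>0. \<forall>w\<in>carrier_vec N. frame_sum v {..<M} w \<le> L * form y w"
proof -
  obtain L where L: "\<And>i. i < M \<Longrightarrow> L i \<ge> 0 \<and> (\<forall>w\<in>carrier_vec N. (cmod (w \<bullet>c v i))\<^sup>2 \<le> L i * form y w)"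
    using cmod_sq_le_form[OF det psd] by metis
  show ?thesis
  proof (intro exI[of _ "\<Sum>i<M. L i"] conjI ballI)
    show "(\<Sum>i<M. L i) \<ge> 0" using L by (intro sum_nonneg) auto
    fix w :: "complex vec" assume "w \<in> carrier_vec N"
    then show "frame_sum v {..<M} w \<le> (\<Sum>i<M. L i) * form y w"
      unfolding frame_sum_def sum_distrib_right using L by (intro sum_mono) auto
  qed
qed

text \<open>Let \<open>s0\<close> be the infimum of the shifts s \<ge> 0 at which the form is
  semidefinite; it is semidefinite at \<open>s0\<close> too. If \<open>s0\<close> were positive,
  nonsingularity there would give a margin L, and the shift could be lowered by some h > 0 with h L
  \<le> 1. Hence \<open>s0\<close> = 0.\<close>

lemma form_nonneg:
  assumes det: "\<And>s. s \<ge> 0 \<Longrightarrow> det (frame_mat N M v (\<lambda>i. of_real (y i + s))) \<noteq> 0"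
    and w: "w \<in> carrier_vec N"
  shows "form y w \<ge> 0"
proof -
  define T where "T = {s. s \<ge> 0 \<and> (\<forall>w\<in>carrier_vec N. form (\<lambda>i. y i + s) w \<ge> 0)}"
  define s1 where "s1 = (\<Sum>i<M. \<bar>y i\<bar>)"
  have "s1 \<in> T"
  proof -
    have "y i + s1 \<ge> 0" if "i < M" for i
      using member_le_sum[of i "{..<M}" "\<lambda>i. \<bar>y i\<bar>"] that by (simp add: s1_def)
    then have "form (\<lambda>i. y i + s1) w \<ge> 0" for w unfolding form_def by (intro sum_nonneg) auto
    then show ?thesis by (simp add: T_def s1_def sum_nonneg)
  qed
  define s0 where "s0 = Inf T"
  have bdd: "bdd_below T" by (rule bdd_belowI[of _ 0]) (simp add: T_def)
  have s0: "s0 \<ge> 0" unfolding s0_def using \<open>s1 \<in> T\<close> by (intro cInf_greatest) (auto simp: T_def)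
  have psd: "form (\<lambda>i. y i + s0) w \<ge> 0" if w: "w \<in> carrier_vec N" for w
  proof (rule ccontr)
    assume *: "\<not> ?thesis"
    define B where "B = frame_sum v {..<M} w"
    have B: "B \<ge> 0" by (simp add: B_def frame_sum_nonneg)
    have f: "form (\<lambda>i. y i + s) w = form y w + s * B" for s
      unfolding form_shift B_def ..
    \<comment> \<open>Chosen so that the form with shift \<open>s0 + e\<close> still has the
      negative value - e at w.\<close>
    define e where "e = - form (\<lambda>i. y i + s0) w / (B + 1)"
    have e: "e > 0" using * B by (simp add: e_def divide_neg_pos)
    obtain s where s: "s \<in> T" "s < s0 + e"
      using cInf_lessD[of T "s0 + e"] \<open>s1 \<in> T\<close> e unfolding s0_def by auto
    have "0 \<le> form y w + s * B" using s(1) w f by (auto simp: T_def)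
    also have "s * B \<le> (s0 + e) * B" using s(2) B by (intro mult_right_mono) auto
    also have "form y w + (s0 + e) * B = form (\<lambda>i. y i + s0) w + e * B"
      unfolding f by (simp add: algebra_simps)
    also have "\<dots> = - e" using B by (simp add: e_def field_simps)
    finally show False using e by simp
  qed
  have "s0 = 0"
  proof (rule ccontr)
    assume "s0 \<noteq> 0"
    then have s0': "s0 > 0" using s0 by simp
    obtain L where L: "L \<ge> 0"
      "\<And>w. w \<in> carrier_vec N \<Longrightarrow> frame_sum v {..<M} w \<le> L * form (\<lambda>i. y i + s0) w"
      using frame_sum_le_form[OF det[OF s0] psd] by blast
    define h where "h = min s0 (1 / (L + 1))"
    have h: "h > 0" "h \<le> s0" using s0' L(1) by (auto simp: h_def)
    have "h \<le> 1 / (L + 1)" by (simp add: h_def)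
    then have "h * (L + 1) \<le> 1" using L(1) by (simp add: field_simps)
    then have hL: "h * L \<le> 1" using h(1) by (simp add: algebra_simps)
    have "s0 - h \<in> T"
      unfolding T_def
    proof (intro CollectI conjI ballI)
      fix w :: "complex vec" assume w: "w \<in> carrier_vec N"
      have "h * frame_sum v {..<M} w \<le> h * (L * form (\<lambda>i. y i + s0) w)"
        using L(2)[OF w] h(1) by (intro mult_left_mono) auto
      also have "\<dots> \<le> form (\<lambda>i. y i + s0) w"
        using mult_right_mono[OF hL psd[OF w]] by (simp add: mult.assoc)
      finally show "form (\<lambda>i. y i + (s0 - h)) w \<ge> 0"
        unfolding form_shift by (simp add: algebra_simps)
    qed (use h in simp)
    then have "s0 \<le> s0 - h" unfolding s0_def[symmetric] using cInf_lower[OF _ bdd] by (simp add: s0_def)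
    then show False using h by simp
  qed
  then show ?thesis using psd[OF w] by simp
qed

text \<open>Weaver's theorem for two blocks, relative to the frame operator: \<open>\<epsilon>\<close> bounds the leverage
  scores \<open>\<langle>B\<^sup>-\<^sup>1 v\<^sub>i, v\<^sub>i\<rangle>\<close>, so the frame need not be tight.\<close>

theorem weaver_partition:
  assumes \<epsilon>: "\<epsilon> > 0"
    and lev: "\<And>i w. i < M \<Longrightarrow> w \<in> carrier_vec N \<Longrightarrow>
      (cmod (w \<bullet>c v i))\<^sup>2 \<le> \<epsilon> * frame_sum v {..<M} w"
  shows "\<exists>S\<subseteq>{..<M}. \<forall>w\<in>carrier_vec N.
    2 * frame_sum v S w \<le> (1 + sqrt (2 * \<epsilon>))\<^sup>2 * frame_sum v {..<M} w \<and>
    2 * frame_sum v ({..<M} - S) w \<le> (1 + sqrt (2 * \<epsilon>))\<^sup>2 * frame_sum v {..<M} w"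
proof -
  let ?q = "\<lambda>z. det (frame_mat N M v z)"
  define \<beta> where "\<beta> = (1 + sqrt (2 * \<epsilon>))\<^sup>2"
  have "\<exists>S. \<forall>x\<ge>(1 + sqrt (2 * \<epsilon>))\<^sup>2.
    ?q (\<lambda>i. of_real (if i \<in> S then x - 2 else x)) \<noteq> 0 \<and>
    ?q (\<lambda>i. of_real (if i \<in> S then x else x - 2)) \<noteq> 0"
  proof (rule barrier_partition[OF frame_det_multiaffine stable_det _ _ \<epsilon>])
    show "?q z = ?q z'" if "\<And>i. i < M \<Longrightarrow> z i = z' i" for z z'
      using frame_mat_cong[of M z z' N v] that by simp
  qed (use det_nonzero_pos log_deriv_det_le[OF _ _ \<epsilon> lev] in auto)
  then obtain S where S: "\<And>x. x \<ge> \<beta> \<Longrightarrow> ?q (\<lambda>i. of_real (if i \<in> S then x - 2 else x)) \<noteq> 0"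
    "\<And>x. x \<ge> \<beta> \<Longrightarrow> ?q (\<lambda>i. of_real (if i \<in> S then x else x - 2)) \<noteq> 0"
    unfolding \<beta>_def by blast
  \<comment> \<open>With weight \<beta> - 2 on S' and \<beta> elsewhere, the form is \<beta> times
    the full frame sum minus twice the one over S'. Larger x are shifts of these weights, so
    nonvanishing for all x \<ge> \<beta> is what \<open>form_nonneg\<close> asks for.\<close>
  have half: "2 * frame_sum v (S' \<inter> {..<M}) w \<le> \<beta> * frame_sum v {..<M} w"
    if S': "\<And>x. x \<ge> \<beta> \<Longrightarrow> ?q (\<lambda>i. of_real (if i \<in> S' then x - 2 else x)) \<noteq> 0"
      and w: "w \<in> carrier_vec N" for S' w
  proof -
    define y where "y i = (if i \<in> S' then \<beta> - 2 else \<beta>)" for i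
    have "?q (\<lambda>i. of_real (y i + s)) \<noteq> 0" if "s \<ge> 0" for s
    proof -
      have eq: "(\<lambda>i. complex_of_real (y i + s)) = (\<lambda>i. of_real (if i \<in> S' then (\<beta> + s) - 2 else \<beta> + s))"
        by (auto simp: y_def fun_eq_iff)
      show ?thesis unfolding eq by (rule S') (use that in simp)
    qed
    from form_nonneg[OF this w] have "0 \<le> form y w" .
    also have "form y w = (\<Sum>i<M. \<beta> * (cmod (w \<bullet>c v i))\<^sup>2 -
        (if i \<in> S' then 2 * (cmod (w \<bullet>c v i))\<^sup>2 else 0))"
      unfolding form_def by (intro sum.cong refl) (auto simp: y_def algebra_simps)
    also have "\<dots> = \<beta> * frame_sum v {..<M} w - 2 * frame_sum v (S' \<inter> {..<M}) w"
      unfolding sum_subtractf frame_sum_def sum_distrib_left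
      by (simp add: sum.inter_restrict Int_commute[of S'])
    finally show ?thesis by simp
  qed
  show ?thesis
  proof (intro exI[of _ "S \<inter> {..<M}"] conjI ballI)
    fix w :: "complex vec" assume w: "w \<in> carrier_vec N"
    show "2 * frame_sum v (S \<inter> {..<M}) w \<le> (1 + sqrt (2 * \<epsilon>))\<^sup>2 * frame_sum v {..<M} w"
      using half[OF S(1) w] by (simp add: \<beta>_def)
    have "?q (\<lambda>i. of_real (if i \<in> - S then x - 2 else x)) \<noteq> 0" if "x \<ge> \<beta>" for x
    proof -
      have eq: "(\<lambda>i. complex_of_real (if i \<in> - S then x - 2 else x)) =
          (\<lambda>i. of_real (if i \<in> S then x else x - 2))" by auto
      show ?thesis unfolding eq by (rule S(2)[OF that])
    qed
    moreover have "{..<M} - S \<inter> {..<M} = - S \<inter> {..<M}" by auto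
    ultimately show "2 * frame_sum v ({..<M} - S \<inter> {..<M}) w \<le> (1 + sqrt (2 * \<epsilon>))\<^sup>2 * frame_sum v {..<M} w"
      using half[of "- S", OF _ w] by (simp add: \<beta>_def)
  qed simp
qed

end

section \<open>Property (P) and the weights\<close>

lemma cvec_norm_sq: "(cvec_norm w)\<^sup>2 = (\<Sum>i<dim_vec w. (cmod (vec_index w i))\<^sup>2)"
  unfolding cvec_norm_def by (rule real_sqrt_pow2) (auto intro: sum_nonneg)

lemma cvec_norm_sq_pos:
  assumes "w \<in> carrier_vec N" "w \<noteq> 0\<^sub>v N" shows "(cvec_norm w)\<^sup>2 > 0"
proof -
  obtain i where i: "i < N" "vec_index w i \<noteq> 0" using assms by (metis carrier_vecD eq_vecI index_zero_vec)
  have "(\<Sum>i<dim_vec w. (cmod (vec_index w i))\<^sup>2) > 0"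
    using i assms by (intro sum_pos2[of _ i]) auto
  then show ?thesis by (simp only: cvec_norm_sq)
qed

lemma cauchy_schwarz_cvec:
  assumes w: "w \<in> carrier_vec N" and u: "u \<in> carrier_vec N"
  shows "(cmod (w \<bullet>c u))\<^sup>2 \<le> (cvec_norm w)\<^sup>2 * (cvec_norm u)\<^sup>2"
proof -
  have "cmod (w \<bullet>c u) \<le> (\<Sum>b<N. cmod (vec_index w b) * cmod (vec_index u b))"
    unfolding cscalar_prod_eq[OF u] by (rule order_trans[OF norm_sum]) (simp add: norm_mult)
  then have "(cmod (w \<bullet>c u))\<^sup>2 \<le> (\<Sum>b<N. cmod (vec_index w b) * cmod (vec_index u b))\<^sup>2"
    by (intro power_mono) auto
  also have "\<dots> \<le> (\<Sum>b<N. (cmod (vec_index w b))\<^sup>2) * (\<Sum>b<N. (cmod (vec_index u b))\<^sup>2)"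
    by (rule Cauchy_Schwarz_ineq_sum)
  also have "\<dots> = (cvec_norm w)\<^sup>2 * (cvec_norm u)\<^sup>2"
    using w u by (simp add: cvec_norm_sq)
  finally show ?thesis .
qed

text \<open>Cauchy-Schwarz and the lower frame bound give leverage scores at most \<delta> / a. Of
  the two blocks the one with fewer indices is kept, and the upper bound for the other becomes its
  lower bound.\<close>

lemma frame_halving:
  fixes J :: "nat set"
  assumes J: "finite J" "\<And>j. j \<in> J \<Longrightarrow> v j \<in> carrier_vec N"
    and a: "a > 0" and \<delta>: "\<delta> > 0"
    and lower: "\<And>w. w \<in> carrier_vec N \<Longrightarrow> a * (cvec_norm w)\<^sup>2 \<le> frame_sum v J w"
    and small: "\<And>j. j \<in> J \<Longrightarrow> (cvec_norm (v j))\<^sup>2 \<le> \<delta>"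
  defines "\<beta> \<equiv> (1 + sqrt (2 * (\<delta> / a)))\<^sup>2"
  shows "\<exists>J'\<subseteq>J. 2 * card J' \<le> card J \<and> (\<forall>w\<in>carrier_vec N.
    (2 - \<beta>) * frame_sum v J w \<le> 2 * frame_sum v J' w \<and> 2 * frame_sum v J' w \<le> \<beta> * frame_sum v J w)"
proof -
  obtain M where M: "J \<subseteq> {..<M}" using finite_nat_bounded[OF J(1)] by blast
  \<comment> \<open>Zero vectors extend the index set to an initial segment without changing any
    frame sum.\<close>
  define u where "u j = (if j \<in> J then v j else 0\<^sub>v N)" for j
  have u: "u j \<in> carrier_vec N" for j using J(2) by (simp add: u_def)
  have sum_u: "frame_sum u S w = frame_sum v (S \<inter> J) w" if "w \<in> carrier_vec N" "finite S" for S w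
  proof -
    have "frame_sum u S w = (\<Sum>j\<in>S. if j \<in> J then (cmod (w \<bullet>c v j))\<^sup>2 else 0)"
      unfolding frame_sum_def using that by (intro sum.cong refl) (simp add: u_def)
    then show ?thesis using that by (simp add: frame_sum_def sum.inter_restrict)
  qed
  have MJ: "{..<M} \<inter> J = J" using M by blast
  interpret frame N M u
  proof
    fix w :: "complex vec" assume w: "w \<in> carrier_vec N" "w \<noteq> 0\<^sub>v N"
    have "0 < a * (cvec_norm w)\<^sup>2" using a cvec_norm_sq_pos[OF w] by simp
    also have "\<dots> \<le> frame_sum u {..<M} w" using lower[OF w(1)] sum_u[OF w(1)] by (simp add: MJ)
    finally show "frame_sum u {..<M} w > 0" .
  qed (rule u)
  have lev: "(cmod (w \<bullet>c u i))\<^sup>2 \<le> \<delta> / a * frame_sum u {..<M} w" if w: "w \<in> carrier_vec N" for i w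
  proof (cases "i \<in> J")
    case True
    have "(cmod (w \<bullet>c u i))\<^sup>2 \<le> (cvec_norm w)\<^sup>2 * (cvec_norm (v i))\<^sup>2"
      using cauchy_schwarz_cvec[OF w J(2)[OF True]] True by (simp add: u_def)
    also have "\<dots> \<le> (cvec_norm w)\<^sup>2 * \<delta>" using small[OF True] by (intro mult_left_mono) auto
    also have "\<dots> = \<delta> / a * (a * (cvec_norm w)\<^sup>2)" using a by simp
    also have "\<dots> \<le> \<delta> / a * frame_sum v J w"
      using lower[OF w] a \<delta> by (intro mult_left_mono) auto
    finally show ?thesis using sum_u[OF w] by (simp add: MJ)
  next
    case False
    then show ?thesis using w a \<delta> by (simp add: u_def frame_sum_nonneg)
  qed
  obtain S where S: "S \<subseteq> {..<M}"
    "\<And>w. w \<in> carrier_vec N \<Longrightarrow> 2 * frame_sum u S w \<le> \<beta> * frame_sum u {..<M} w"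
    "\<And>w. w \<in> carrier_vec N \<Longrightarrow> 2 * frame_sum u ({..<M} - S) w \<le> \<beta> * frame_sum u {..<M} w"
    using weaver_partition[of "\<delta> / a", OF _ lev] a \<delta> unfolding \<beta>_def by auto
  define A where "A = S \<inter> J"
  define B where "B = J - S"
  have finS: "finite S" using S(1) finite_subset by blast
  have AB: "A \<union> B = J" "A \<inter> B = {}" "finite A" "finite B" using J(1) by (auto simp: A_def B_def)
  have B_eq: "({..<M} - S) \<inter> J = B" using M by (auto simp: B_def)
  have up: "2 * frame_sum v A w \<le> \<beta> * frame_sum v J w" "2 * frame_sum v B w \<le> \<beta> * frame_sum v J w"
    if w: "w \<in> carrier_vec N" for w
    using S(2)[OF w] S(3)[OF w] sum_u[OF w finS] sum_u[OF w, of "{..<M}"] sum_u[OF w, of "{..<M} - S"]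
    by (simp_all add: MJ B_eq A_def)
  have split: "frame_sum v J w = frame_sum v A w + frame_sum v B w" for w
    unfolding frame_sum_def AB(1)[symmetric] using AB by (intro sum.union_disjoint) auto
  have card: "card J = card A + card B" unfolding AB(1)[symmetric] using AB by (intro card_Un_disjoint) auto
  show ?thesis
  proof (cases "card A \<le> card B")
    case True
    show ?thesis
      by (rule exI[of _ A]) (use True card AB up split in \<open>auto simp: left_diff_distrib\<close>)
  next
    case False
    show ?thesis
      by (rule exI[of _ B]) (use False card AB up split in \<open>auto simp: left_diff_distrib\<close>)
  qed
qed

text \<open>Each halving loses the relative factor \<open>(1 + \<eta>) / (1 - \<eta>)\<close> with \<open>\<eta> \<le> 4 \<surd>(\<delta>/a)\<close>. As \<open>\<delta>/a\<close> at least
  doubles, these losses form a geometric series that the exponential absorbs.\<close>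

lemma halving_constants:
  fixes a b \<delta> :: real
  assumes a: "a > 0" "100 * \<delta> \<le> a" and \<delta>: "\<delta> > 0" and b: "b \<le> a * exp (30 * sqrt (\<delta> / a))"
  defines "\<beta> \<equiv> (1 + sqrt (2 * (\<delta> / a)))\<^sup>2"
  defines "a' \<equiv> a * (2 - \<beta>) / 2" and "b' \<equiv> b * \<beta> / 2"
  shows "1 \<le> \<beta>" "a / 3 \<le> a'" "a' \<le> a / 2" "b' \<le> a' * exp (30 * sqrt (\<delta> / a'))"
proof -
  define r where "r = sqrt (\<delta> / a)"
  define \<eta> where "\<eta> = 2 * sqrt 2 * r + 2 * r\<^sup>2"
  have r0: "r > 0" using a \<delta> by (simp add: r_def)
  have r2: "r\<^sup>2 = \<delta> / a" using a \<delta> by (simp add: r_def)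
  have "r\<^sup>2 \<le> (1 / 10)\<^sup>2" unfolding r2 using a by (simp add: field_simps power2_eq_square)
  then have r1: "r \<le> 1 / 10" by (rule power2_le_imp_le) simp
  have s2: "sqrt 2 \<le> 1.5" "1.4 \<le> sqrt 2"
    by (rule real_le_lsqrt real_le_rsqrt; simp add: power2_eq_square)+
  have \<beta>: "\<beta> = 1 + \<eta>"
    unfolding \<beta>_def \<eta>_def real_sqrt_mult r_def[symmetric]
    by (simp add: power2_eq_square algebra_simps)
  have \<eta>0: "\<eta> > 0" using r0 by (simp add: \<eta>_def add_pos_pos)
  have "2 * sqrt 2 * r \<le> 3 * r" using s2 r0 by simp
  moreover have "r\<^sup>2 \<le> r / 10" using mult_left_mono[OF r1, of r] r0 by (simp add: power2_eq_square)
  ultimately have \<eta>r: "\<eta> \<le> 3.2 * r" unfolding \<eta>_def by linarith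
  then have \<eta>1: "\<eta> \<le> 1 / 3" using r1 by linarith
  show "1 \<le> \<beta>" using \<beta> \<eta>0 by simp
  have a'_eq: "a' = a * (1 - \<eta>) / 2" by (simp add: a'_def \<beta>)
  show "a / 3 \<le> a'" unfolding a'_eq using a \<eta>1 by (simp add: field_simps)
  show a'_le: "a' \<le> a / 2" unfolding a'_eq using a \<eta>0 by (simp add: field_simps)
  have a'0: "a' > 0" unfolding a'_eq using a \<eta>1 by simp
  \<comment> \<open>Equivalent to 3 \<eta>^2 \<le> \<eta>, so \<eta> \<le> 1/3 suffices; the
    relative loss is then at most exp (3 \<eta>).\<close>
  have "(1 + \<eta>) \<le> (1 - \<eta>) * (1 + 3 * \<eta>)"
    using mult_right_mono[of "3 * \<eta>" 1 \<eta>] \<eta>0 \<eta>1 by (simp add: algebra_simps)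
  also have "\<dots> \<le> (1 - \<eta>) * exp (3 * \<eta>)"
    using \<eta>1 by (intro mult_left_mono exp_ge_add_one_self) auto
  finally have e1: "1 + \<eta> \<le> (1 - \<eta>) * exp (3 * \<eta>)" .
  have "1.4 * r \<le> sqrt 2 * r" using s2 r0 by simp
  also have "\<dots> = sqrt (2 * (\<delta> / a))" by (simp only: r_def real_sqrt_mult)
  also have "\<dots> \<le> sqrt (\<delta> / a')"
  proof (rule real_sqrt_le_mono)
    have "2 * (\<delta> / a) = \<delta> / (a / 2)" by simp
    also have "\<dots> \<le> \<delta> / a'" using a'_le a'0 \<delta> by (intro divide_left_mono) auto
    finally show "2 * (\<delta> / a) \<le> \<delta> / a'" .
  qed
  \<comment> \<open>The constant 30 leaves enough room: 3 \<eta> \<le> 9.6 r, and 30 r + 9.6 r \<le>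
    30 * 1.4 r.\<close>
  finally have e2: "30 * r + 3 * \<eta> \<le> 30 * sqrt (\<delta> / a')" using \<eta>r r0 by linarith
  have "b' \<le> a * exp (30 * r) * (1 + \<eta>) / 2"
    unfolding b'_def \<beta> using b \<eta>0 by (simp add: r_def)
  also have "\<dots> \<le> a * exp (30 * r) * ((1 - \<eta>) * exp (3 * \<eta>)) / 2"
    using e1 a by (intro divide_right_mono mult_left_mono) auto
  also have "\<dots> = a' * exp (30 * r + 3 * \<eta>)" by (simp add: a'_eq exp_add)
  also have "\<dots> \<le> a' * exp (30 * sqrt (\<delta> / a'))" using e2 a'0 by simp
  finally show "b' \<le> a' * exp (30 * sqrt (\<delta> / a'))" .
qed

text \<open>Each halving at least halves a, so n bounds the number of rounds until a < 100 \<delta>.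
  The invariant \<delta> \<le> a then bounds b by 100 exp 30 \<delta>. The cardinality stays below b
  K, since it is halved while b is multiplied by \<beta> / 2 with \<beta> \<ge> 1.\<close>

lemma iterated_halving:
  fixes J :: "nat set" and K :: real
  assumes \<delta>: "\<delta> > 0"
    and J: "finite J" "\<And>j. j \<in> J \<Longrightarrow> v j \<in> carrier_vec N" "\<And>j. j \<in> J \<Longrightarrow> (cvec_norm (v j))\<^sup>2 \<le> \<delta>"
    and bounds: "\<And>w. w \<in> carrier_vec N \<Longrightarrow> a * (cvec_norm w)\<^sup>2 \<le> frame_sum v J w"
      "\<And>w. w \<in> carrier_vec N \<Longrightarrow> frame_sum v J w \<le> b * (cvec_norm w)\<^sup>2"
    and ab: "\<delta> \<le> a" "b \<le> a * exp (30 * sqrt (\<delta> / a))"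
    and K: "K \<ge> 0" "real (card J) \<le> b * K"
    and n: "a < 2 ^ n * (100 * \<delta>)"
  shows "\<exists>J'\<subseteq>J. real (card J') \<le> 100 * exp 30 * \<delta> * K \<and> (\<forall>w\<in>carrier_vec N.
    \<delta> * (cvec_norm w)\<^sup>2 \<le> frame_sum v J' w \<and> frame_sum v J' w \<le> 100 * exp 30 * \<delta> * (cvec_norm w)\<^sup>2)"
  using J bounds ab K(2) n
proof (induction n arbitrary: J a b)
  case (0 J a b)
  have a: "a > 0" using 0 \<delta> by linarith
  have "b \<le> a * exp (30 * sqrt (\<delta> / a))" by fact
  also have "\<dots> \<le> a * exp (30 * 1)"
    using a \<open>\<delta> \<le> a\<close> \<delta> by (intro mult_left_mono) auto
  also have "\<dots> \<le> 100 * \<delta> * exp 30" using \<open>a < 2 ^ 0 * (100 * \<delta>)\<close> by simp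
  finally have b: "b \<le> 100 * exp 30 * \<delta>" by (simp add: mult_ac)
  show ?case
  proof (intro exI[of _ J] conjI ballI)
    show "real (card J) \<le> 100 * exp 30 * \<delta> * K"
      using \<open>real (card J) \<le> b * K\<close> mult_right_mono[OF b K(1)] by linarith
    fix w :: "complex vec" assume w: "w \<in> carrier_vec N"
    show "\<delta> * (cvec_norm w)\<^sup>2 \<le> frame_sum v J w"
      using 0(4)[OF w] mult_right_mono[OF \<open>\<delta> \<le> a\<close>, of "(cvec_norm w)\<^sup>2"] by simp
    show "frame_sum v J w \<le> 100 * exp 30 * \<delta> * (cvec_norm w)\<^sup>2"
      using 0(5)[OF w] mult_right_mono[OF b, of "(cvec_norm w)\<^sup>2"] by simp
  qed simp
next
  case (Suc n J a b)
  have a: "a > 0" using Suc.prems \<delta> by linarith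
  show ?case
  proof (cases "a < 2 ^ n * (100 * \<delta>)")
    case True
    then show ?thesis using Suc.IH[of J a b] Suc.prems by blast
  next
    case False
    have "100 * \<delta> \<le> 2 ^ n * (100 * \<delta>)" using \<delta> by simp
    then have a100: "100 * \<delta> \<le> a" using False by linarith
    define \<beta> where "\<beta> = (1 + sqrt (2 * (\<delta> / a)))\<^sup>2"
    define a' where "a' = a * (2 - \<beta>) / 2"
    define b' where "b' = b * \<beta> / 2"
    note step_bounds = halving_constants[OF a a100 \<delta> Suc.prems(7), folded \<beta>_def, folded a'_def b'_def]
    obtain J' where J': "J' \<subseteq> J" "2 * card J' \<le> card J"
      "\<And>w. w \<in> carrier_vec N \<Longrightarrow> (2 - \<beta>) * frame_sum v J w \<le> 2 * frame_sum v J' w"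
      "\<And>w. w \<in> carrier_vec N \<Longrightarrow> 2 * frame_sum v J' w \<le> \<beta> * frame_sum v J w"
      using frame_halving[OF Suc.prems(1,2) a \<delta> Suc.prems(4,3)] unfolding \<beta>_def by blast
    have "a * (2 - \<beta>) > 0" using step_bounds(2) a by (simp add: a'_def)
    then have \<beta>2: "2 - \<beta> > 0" using a by (simp add: zero_less_mult_iff)
    have "\<exists>J''\<subseteq>J'. real (card J'') \<le> 100 * exp 30 * \<delta> * K \<and> (\<forall>w\<in>carrier_vec N.
      \<delta> * (cvec_norm w)\<^sup>2 \<le> frame_sum v J'' w \<and> frame_sum v J'' w \<le> 100 * exp 30 * \<delta> * (cvec_norm w)\<^sup>2)"
    proof (rule Suc.IH[of J' a' b'])
      show "finite J'" using J'(1) Suc.prems(1) by (rule finite_subset)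
      show "a' * (cvec_norm w)\<^sup>2 \<le> frame_sum v J' w" if w: "w \<in> carrier_vec N" for w
      proof -
        have "(2 - \<beta>) * (a * (cvec_norm w)\<^sup>2) \<le> (2 - \<beta>) * frame_sum v J w"
          using Suc.prems(4)[OF w] \<beta>2 by (intro mult_left_mono) auto
        then show ?thesis using J'(3)[OF w] by (simp add: a'_def mult_ac)
      qed
      show "frame_sum v J' w \<le> b' * (cvec_norm w)\<^sup>2" if w: "w \<in> carrier_vec N" for w
      proof -
        have "\<beta> * frame_sum v J w \<le> \<beta> * (b * (cvec_norm w)\<^sup>2)"
          using Suc.prems(5)[OF w] step_bounds(1) by (intro mult_left_mono) auto
        then show ?thesis using J'(4)[OF w] by (simp add: b'_def mult_ac)
      qed
      show "\<delta> \<le> a'" using step_bounds(2) a100 \<delta> by linarith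
      show "a' < 2 ^ n * (100 * \<delta>)" using step_bounds(3) Suc.prems(9) by simp
      have "2 * real (card J') \<le> b * K" using J'(2) Suc.prems(8) by linarith
      also have "\<dots> \<le> \<beta> * (b * K)"
        using mult_right_mono[OF step_bounds(1), of "b * K"] Suc.prems(8) by simp
      finally show "real (card J') \<le> b' * K" by (simp add: b'_def mult_ac)
    qed (use J'(1) Suc.prems(2,3) step_bounds(4) in auto)
    then show ?thesis using J'(1) by blast
  qed
qed

section \<open>Parseval systems and property (P)\<close>

lemma parseval_carrier: "parseval_system M N v \<Longrightarrow> j \<in> {1..M} \<Longrightarrow> v j \<in> carrier_vec N"
  by (simp add: parseval_system_def)

lemma parseval_frame_sum:
  "parseval_system M N v \<Longrightarrow> w \<in> carrier_vec N \<Longrightarrow> frame_sum v {1..M} w = (cvec_norm w)\<^sup>2"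
  by (simp add: parseval_system_def frame_sum_def)

lemma cscalar_unit_vec:
  "u \<in> carrier_vec N \<Longrightarrow> a < N \<Longrightarrow> unit_vec N a \<bullet>c u = cnj (vec_index u a)" for u :: "complex vec"
  by (simp add: scalar_prod_left_unit)

lemma cvec_norm_unit_vec: "a < N \<Longrightarrow> (cvec_norm (unit_vec N a))\<^sup>2 = 1"
  by (simp add: cvec_norm_sq if_distrib[of cmod] if_distrib[of "\<lambda>x. x\<^sup>2"] cong: if_cong)

text \<open>The trace of the identity: sum the Parseval identity over the standard basis and
  exchange the sums.\<close>

lemma parseval_trace:
  assumes v: "parseval_system M N v"
  shows "(\<Sum>j=1..M. (cvec_norm (v j))\<^sup>2) = real N"
proof -
  have "(\<Sum>j=1..M. (cvec_norm (v j))\<^sup>2) = (\<Sum>j=1..M. \<Sum>a<N. (cmod (unit_vec N a \<bullet>c v j))\<^sup>2)"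
  proof (intro sum.cong refl)
    fix j assume "j \<in> {1..M}"
    then have "v j \<in> carrier_vec N" by (rule parseval_carrier[OF v])
    then show "(cvec_norm (v j))\<^sup>2 = (\<Sum>a<N. (cmod (unit_vec N a \<bullet>c v j))\<^sup>2)"
      by (simp add: cvec_norm_sq cscalar_unit_vec)
  qed
  also have "\<dots> = (\<Sum>a<N. frame_sum v {1..M} (unit_vec N a))"
    unfolding frame_sum_def by (rule sum.swap)
  also have "\<dots> = (\<Sum>a<N. 1)"
    by (intro sum.cong refl) (use parseval_frame_sum[OF v] in \<open>simp add: cvec_norm_unit_vec\<close>)
  finally show ?thesis by simp
qed

text \<open>Iterated halving with \<delta> = \<theta> N / M, started from the whole system, where a
  = b = 1 and K = M; the result is rescaled by M / N.\<close>

lemma property_P_holds: "property_P 1 (100 * exp 30) (100 * exp 30)"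
  unfolding property_P_def
proof (intro allI impI)
  fix M N :: nat and v and \<theta> :: real
  assume M: "1 \<le> M" and N: "1 \<le> N" and v: "parseval_system M N v"
    and \<theta>: "\<theta> \<le> real M / real N"
    and small: "\<forall>j\<in>{1..M}. (cvec_norm (v j))\<^sup>2 \<le> \<theta> * real N / real M"
  define \<delta> where "\<delta> = \<theta> * real N / real M"
  \<comment> \<open>Positivity of \<theta> follows from the trace: the squared norms sum to N >
    0.\<close>
  have "real N \<le> (\<Sum>j=1..M. \<delta>)"
    unfolding parseval_trace[OF v, symmetric] using small by (intro sum_mono) (simp add: \<delta>_def)
  then have "0 < real M * \<delta>" using N by simp
  then have "\<delta> > 0" using M by (simp add: zero_less_mult_iff)
  have "\<delta> \<le> 1" using \<theta> M N by (simp add: \<delta>_def field_simps)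
  obtain n where n: "1 / (100 * \<delta>) < 2 ^ n" using real_arch_pow[of 2 "1 / (100 * \<delta>)"] by auto
  have "\<exists>J'\<subseteq>{1..M}. real (card J') \<le> 100 * exp 30 * \<delta> * real M \<and> (\<forall>w\<in>carrier_vec N.
    \<delta> * (cvec_norm w)\<^sup>2 \<le> frame_sum v J' w \<and> frame_sum v J' w \<le> 100 * exp 30 * \<delta> * (cvec_norm w)\<^sup>2)"
  proof (rule iterated_halving[where a = 1 and b = 1 and n = n])
    show "1 < 2 ^ n * (100 * \<delta>)" using n \<open>\<delta> > 0\<close> by (simp add: field_simps)
  qed (use \<open>\<delta> > 0\<close> \<open>\<delta> \<le> 1\<close> small parseval_carrier[OF v] parseval_frame_sum[OF v] in
      \<open>auto simp: \<delta>_def[symmetric]\<close>)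
  then obtain J where J: "J \<subseteq> {1..M}" "real (card J) \<le> 100 * exp 30 * \<delta> * real M"
    "\<And>w. w \<in> carrier_vec N \<Longrightarrow> \<delta> * (cvec_norm w)\<^sup>2 \<le> frame_sum v J w"
    "\<And>w. w \<in> carrier_vec N \<Longrightarrow> frame_sum v J w \<le> 100 * exp 30 * \<delta> * (cvec_norm w)\<^sup>2" by blast
  have \<delta>M: "\<delta> * real M = \<theta> * real N" using M by (simp add: \<delta>_def)
  have \<theta>_eq: "real M / real N * \<delta> = \<theta>" using M N by (simp add: \<delta>_def)
  show "\<exists>J\<subseteq>{1..M}. real (card J) \<le> 100 * exp 30 * \<theta> * real N \<and> (\<forall>w\<in>carrier_vec N.
      1 * \<theta> * (cvec_norm w)\<^sup>2 \<le> real M / real N * (\<Sum>j\<in>J. (cmod (w \<bullet>c v j))\<^sup>2) \<and>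
      real M / real N * (\<Sum>j\<in>J. (cmod (w \<bullet>c v j))\<^sup>2) \<le> 100 * exp 30 * \<theta> * (cvec_norm w)\<^sup>2)"
  proof (intro exI[of _ J] conjI ballI)
    show "real (card J) \<le> 100 * exp 30 * \<theta> * real N" using J(2) \<delta>M by (simp only: mult.assoc)
    fix w :: "complex vec" assume w: "w \<in> carrier_vec N"
    have "real M / real N * (\<delta> * (cvec_norm w)\<^sup>2) \<le> real M / real N * frame_sum v J w"
      using J(3)[OF w] by (intro mult_left_mono) auto
    then show "1 * \<theta> * (cvec_norm w)\<^sup>2 \<le> real M / real N * (\<Sum>j\<in>J. (cmod (w \<bullet>c v j))\<^sup>2)"
      unfolding frame_sum_def[symmetric] mult.assoc[symmetric] \<theta>_eq by simp
    have "real M / real N * frame_sum v J w \<le> real M / real N * (100 * exp 30 * \<delta> * (cvec_norm w)\<^sup>2)"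
      using J(4)[OF w] by (intro mult_left_mono) auto
    also have "\<dots> = 100 * exp 30 * (real M / real N * \<delta>) * (cvec_norm w)\<^sup>2" by (simp only: mult_ac)
    finally show "real M / real N * (\<Sum>j\<in>J. (cmod (w \<bullet>c v j))\<^sup>2) \<le> 100 * exp 30 * \<theta> * (cvec_norm w)\<^sup>2"
      unfolding \<theta>_eq frame_sum_def .
  qed (rule J(1))
qed

section \<open>Splitting vectors into copies\<close>

lemma ex_map_with_fibers:
  fixes n :: "nat \<Rightarrow> nat"
  shows "\<exists>g. (\<forall>i\<in>{1..sum n {1..M}}. g i \<in> {1..M}) \<and>
    (\<forall>j\<in>{1..M}. card {i \<in> {1..sum n {1..M}}. g i = j} = n j)"
proof -
  \<comment> \<open>The first component of an enumeration of this disjoint union tells which vector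
    the i-th copy comes from.\<close>
  define D where "D = (SIGMA j:{1..M}. {..<n j})"
  have D: "finite D" "card D = sum n {1..M}" by (simp_all add: D_def)
  obtain h where h: "bij_betw h {1..sum n {1..M}} D"
    using ex_bij_betw_nat_finite_1[OF D(1)] D(2) by auto
  have "card {i \<in> {1..sum n {1..M}}. fst (h i) = j} = n j" if j: "j \<in> {1..M}" for j
  proof -
    have "bij_betw h {i \<in> {1..sum n {1..M}}. fst (h i) = j} {p \<in> D. fst p = j}"
    proof (rule bij_betw_subset[OF h])
      show "h ` {i \<in> {1..sum n {1..M}}. fst (h i) = j} = {p \<in> D. fst p = j}"
        unfolding bij_betw_imp_surj_on[OF h, symmetric] by blast
    qed blast
    then have "card {i \<in> {1..sum n {1..M}}. fst (h i) = j} = card {p \<in> D. fst p = j}"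
      by (rule bij_betw_same_card)
    also have "{p \<in> D. fst p = j} = Pair j ` {..<n j}" using j by (auto simp: D_def)
    also have "card \<dots> = n j" by (simp add: card_image inj_on_def)
    finally show ?thesis .
  qed
  moreover have "fst (h i) \<in> {1..M}" if "i \<in> {1..sum n {1..M}}" for i
  proof -
    have "h i \<in> D" using h that by (auto simp: bij_betw_def)
    then show ?thesis by (auto simp: D_def)
  qed
  ultimately show ?thesis by (intro exI[of _ "\<lambda>i. fst (h i)"]) blast
qed

lemma sum_over_fibers:
  fixes f :: "nat \<Rightarrow> real"
  assumes "finite A" "\<And>i. i \<in> A \<Longrightarrow> g i \<in> {1..M}"
  shows "(\<Sum>i\<in>A. f (g i)) = (\<Sum>j=1..M. real (card {i \<in> A. g i = j}) * f j)"
proof -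
  have "(\<Sum>i\<in>A. f (g i)) = (\<Sum>j=1..M. \<Sum>i\<in>{i \<in> A. g i = j}. f (g i))"
    using assms by (intro sum.group[symmetric]) auto
  also have "\<dots> = (\<Sum>j=1..M. real (card {i \<in> A. g i = j}) * f j)"
    by (intro sum.cong refl) simp
  finally show ?thesis .
qed

text \<open>Replacing each \<open>v\<^sub>j\<close> by \<open>n\<^sub>j\<close> copies of \<open>v\<^sub>j / \<surd>n\<^sub>j\<close> with \<open>n\<^sub>j = \<lceil>\<parallel>v\<^sub>j\<parallel>\<^sup>2 K / N\<rceil>\<close> and \<open>K = M + 2 N\<close> gives a
  Parseval system of between \<open>K\<close> and \<open>2 K\<close> vectors to which property (P) applies with \<open>\<theta> = 2\<close>.\<close>

lemma property_P_weights:
  assumes P: "property_P c0 C0 C1" and M: "M \<ge> 1" and N: "N \<ge> 1" and v: "parseval_system M N v"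
  shows "\<exists>l :: nat \<Rightarrow> real.
    (\<forall>j\<in>{1..M}. l j \<ge> 0) \<and> real (card {j\<in>{1..M}. l j \<noteq> 0}) \<le> 2 * C1 * real N \<and>
    (\<forall>w\<in>carrier_vec N.
       c0 * (cvec_norm w)\<^sup>2 \<le> (\<Sum>j=1..M. l j * (cmod (w \<bullet>c v j))\<^sup>2) \<and>
       (\<Sum>j=1..M. l j * (cmod (w \<bullet>c v j))\<^sup>2) \<le> C0 * (cvec_norm w)\<^sup>2)"
proof -
  \<comment> \<open>Rounding up adds at most M \<le> K, so L \<le> 2 K; and L \<ge> K \<ge> 2 N
    makes \<theta> = 2 admissible.\<close>
  define K where "K = real M + 2 * real N"
  define n where "n j = nat \<lceil>(cvec_norm (v j))\<^sup>2 * K / real N\<rceil>" for j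
  define L where "L = sum n {1..M}"
  have K: "K > 0" "K \<ge> 2 * real N" "K \<ge> real M" using M N by (auto simp: K_def)
  have n_ge: "(cvec_norm (v j))\<^sup>2 * K / real N \<le> real (n j)" for j
    unfolding n_def by (rule real_nat_ceiling_ge)
  have n_le: "real (n j) \<le> (cvec_norm (v j))\<^sup>2 * K / real N + 1" for j
  proof -
    have "0 \<le> (cvec_norm (v j))\<^sup>2 * K / real N" using K by simp
    then show ?thesis unfolding n_def by linarith
  qed
  have tr: "(\<Sum>j=1..M. (cvec_norm (v j))\<^sup>2 * K / real N) = K"
    unfolding sum_divide_distrib[symmetric] sum_distrib_right[symmetric] parseval_trace[OF v]
    using N by simp
  have "K = (\<Sum>j=1..M. (cvec_norm (v j))\<^sup>2 * K / real N)" by (rule tr[symmetric])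
  also have "\<dots> \<le> real L" unfolding L_def of_nat_sum by (intro sum_mono n_ge)
  finally have "K \<le> real L" .
  moreover have "real L \<le> 2 * K"
  proof -
    have "real L \<le> (\<Sum>j=1..M. (cvec_norm (v j))\<^sup>2 * K / real N + 1)"
      unfolding L_def of_nat_sum by (intro sum_mono n_le)
    also have "\<dots> = K + real M" unfolding sum.distrib tr by simp
    finally show ?thesis using K by simp
  qed
  ultimately have L: "K \<le> real L" "real L \<le> 2 * K" .
  have L0: "L \<ge> 1" using L(1) K N by linarith
  obtain g where g: "\<And>i. i \<in> {1..L} \<Longrightarrow> g i \<in> {1..M}"
    "\<And>j. j \<in> {1..M} \<Longrightarrow> card {i \<in> {1..L}. g i = j} = n j"
    using ex_map_with_fibers[of n M] unfolding L_def by blast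
  \<comment> \<open>Only zero vectors get no copies, so the quotients by \<open>n j\<close> = 0,
    which are 0 by convention, lose nothing.\<close>
  have n0: "v j = 0\<^sub>v N" if "j \<in> {1..M}" "n j = 0" for j
  proof (rule ccontr)
    assume "v j \<noteq> 0\<^sub>v N"
    then have "(cvec_norm (v j))\<^sup>2 > 0"
      by (rule cvec_norm_sq_pos[OF parseval_carrier[OF v that(1)]])
    then have "(cvec_norm (v j))\<^sup>2 * K / real N > 0" using K N by simp
    then show False using n_ge[of j] that(2) by simp
  qed
  define u where "u i = complex_of_real (1 / sqrt (real (n (g i)))) \<cdot>\<^sub>v v (g i)" for i
  have u: "(cmod (w \<bullet>c u i))\<^sup>2 = (cmod (w \<bullet>c v (g i)))\<^sup>2 / real (n (g i))"
    if i: "i \<in> {1..L}" and w: "w \<in> carrier_vec N" for i w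
  proof -
    have "w \<bullet>c u i = cnj (complex_of_real (1 / sqrt (real (n (g i))))) * (w \<bullet>c v (g i))"
      using parseval_carrier[OF v g(1)[OF i]] w unfolding u_def
      by (simp add: cscalar_prod_eq[of _ N] sum_distrib_left mult_ac)
    then show ?thesis by (simp add: norm_mult norm_divide power_mult_distrib power_divide)
  qed
  have norm_u: "(cvec_norm (u i))\<^sup>2 = (cvec_norm (v (g i)))\<^sup>2 / real (n (g i))" for i
    unfolding cvec_norm_sq by (simp add: u_def norm_mult norm_divide power_mult_distrib power_divide sum_divide_distrib)
  have sum_u: "(\<Sum>i\<in>A. (cmod (w \<bullet>c u i))\<^sup>2) =
      (\<Sum>j=1..M. real (card {i \<in> A. g i = j}) / real (n j) * (cmod (w \<bullet>c v j))\<^sup>2)"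
    if A: "A \<subseteq> {1..L}" and w: "w \<in> carrier_vec N" for A w
  proof -
    have "(\<Sum>i\<in>A. (cmod (w \<bullet>c u i))\<^sup>2) = (\<Sum>i\<in>A. (cmod (w \<bullet>c v (g i)))\<^sup>2 / real (n (g i)))"
      using A u w by (intro sum.cong refl) auto
    also have "\<dots> = (\<Sum>j=1..M. real (card {i \<in> A. g i = j}) * ((cmod (w \<bullet>c v j))\<^sup>2 / real (n j)))"
      using A g(1) finite_subset[OF A] by (intro sum_over_fibers) auto
    finally show ?thesis by simp
  qed
  have "parseval_system L N u"
    unfolding parseval_system_def
  proof (intro conjI ballI)
    show "u i \<in> carrier_vec N" if "i \<in> {1..L}" for i
      using parseval_carrier[OF v g(1)[OF that]] by (simp add: u_def)
    fix w :: "complex vec" assume w: "w \<in> carrier_vec N"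
    have "(\<Sum>i=1..L. (cmod (w \<bullet>c u i))\<^sup>2) =
        (\<Sum>j=1..M. real (card {i \<in> {1..L}. g i = j}) / real (n j) * (cmod (w \<bullet>c v j))\<^sup>2)"
      by (rule sum_u[OF _ w]) simp
    also have "\<dots> = (\<Sum>j=1..M. (cmod (w \<bullet>c v j))\<^sup>2)"
    proof (intro sum.cong refl)
      fix j assume j: "j \<in> {1..M}"
      show "real (card {i \<in> {1..L}. g i = j}) / real (n j) * (cmod (w \<bullet>c v j))\<^sup>2 = (cmod (w \<bullet>c v j))\<^sup>2"
        unfolding g(2)[OF j] using n0[OF j] w by (cases "n j = 0") auto
    qed
    also have "\<dots> = (cvec_norm w)\<^sup>2" using v w by (simp add: parseval_system_def)
    finally show "(\<Sum>i=1..L. (cmod (w \<bullet>c u i))\<^sup>2) = (cvec_norm w)\<^sup>2" .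
  qed
  moreover have "(2 :: real) \<le> real L / real N" using L(1) K(2) N by (simp add: field_simps)
  moreover have "(cvec_norm (u i))\<^sup>2 \<le> 2 * real N / real L" if i: "i \<in> {1..L}" for i
  proof (cases "n (g i) = 0")
    case False
    have "(cvec_norm (v (g i)))\<^sup>2 * real L \<le> (cvec_norm (v (g i)))\<^sup>2 * (2 * K)"
      using L(2) by (intro mult_left_mono) auto
    also have "\<dots> \<le> 2 * real N * real (n (g i))" using n_ge[of "g i"] N by (simp add: field_simps)
    finally show ?thesis unfolding norm_u using False L0 by (simp add: field_simps)
  qed (simp add: norm_u)
  ultimately obtain J where J: "J \<subseteq> {1..L}" "real (card J) \<le> C1 * 2 * real N"
    "\<And>w. w \<in> carrier_vec N \<Longrightarrow>
      c0 * 2 * (cvec_norm w)\<^sup>2 \<le> real L / real N * (\<Sum>i\<in>J. (cmod (w \<bullet>c u i))\<^sup>2)"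
    "\<And>w. w \<in> carrier_vec N \<Longrightarrow>
      real L / real N * (\<Sum>i\<in>J. (cmod (w \<bullet>c u i))\<^sup>2) \<le> C0 * 2 * (cvec_norm w)\<^sup>2"
    using P[unfolded property_P_def, rule_format, of L N u 2] L0 N by blast
  \<comment> \<open>The selected fraction of the copies of the j-th vector, scaled by L / N and with
    \<theta> = 2 divided out.\<close>
  define l where "l j = real L / real N / 2 * (real (card {i \<in> J. g i = j}) / real (n j))" for j
  have finJ: "finite J" using J(1) finite_subset by blast
  have sum_l: "2 * (\<Sum>j=1..M. l j * (cmod (w \<bullet>c v j))\<^sup>2) =
      real L / real N * (\<Sum>i\<in>J. (cmod (w \<bullet>c u i))\<^sup>2)" if w: "w \<in> carrier_vec N" for w
    unfolding sum_u[OF J(1) w] sum_distrib_left by (intro sum.cong refl) (simp add: l_def)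
  show ?thesis
  proof (intro exI[of _ l] conjI ballI)
    show "l j \<ge> 0" for j by (simp add: l_def)
    \<comment> \<open>A nonzero weight needs a selected copy, so the support has at most
      \<open>card J\<close> elements.\<close>
    have "{j \<in> {1..M}. l j \<noteq> 0} \<subseteq> g ` J"
    proof
      fix j assume "j \<in> {j \<in> {1..M}. l j \<noteq> 0}"
      then have "card {i \<in> J. g i = j} \<noteq> 0" by (auto simp: l_def)
      then have "{i \<in> J. g i = j} \<noteq> {}" by (metis card.empty)
      then show "j \<in> g ` J" by blast
    qed
    then have "card {j \<in> {1..M}. l j \<noteq> 0} \<le> card J"
      using card_mono[OF finite_imageI[OF finJ]] card_image_le[OF finJ] by (meson order_trans)
    then show "real (card {j \<in> {1..M}. l j \<noteq> 0}) \<le> 2 * C1 * real N" using J(2) by simp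
    fix w :: "complex vec" assume w: "w \<in> carrier_vec N"
    show "c0 * (cvec_norm w)\<^sup>2 \<le> (\<Sum>j=1..M. l j * (cmod (w \<bullet>c v j))\<^sup>2)"
      using J(3)[OF w] sum_l[OF w] by simp
    show "(\<Sum>j=1..M. l j * (cmod (w \<bullet>c v j))\<^sup>2) \<le> C0 * (cvec_norm w)\<^sup>2"
      using J(4)[OF w] sum_l[OF w] by simp
  qed
qed

theorem corollary2p1:
  shows "\<exists>c0 C0 C1 :: real. c0 > 0 \<and> C0 > 0 \<and> C1 > 0 \<and>
    property_P c0 C0 C1 \<and>
    (\<forall>M\<ge>1. \<forall>N\<ge>1. \<forall>v. parseval_system M N v \<longrightarrow>
      (\<exists>l :: nat \<Rightarrow> real.
         (\<forall>j\<in>{1..M}. l j \<ge> 0) \<and>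
         real (card {j\<in>{1..M}. l j \<noteq> 0}) \<le> 2 * C1 * real N \<and>
         (\<forall>w\<in>carrier_vec N.
            c0 * (cvec_norm w)\<^sup>2 \<le> (\<Sum>j=1..M. l j * (cmod (w \<bullet>c v j))\<^sup>2) \<and>
            (\<Sum>j=1..M. l j * (cmod (w \<bullet>c v j))\<^sup>2) \<le> C0 * (cvec_norm w)\<^sup>2)))"
  using property_P_holds property_P_weights[OF property_P_holds]
  by (intro exI[of _ 1] exI[of _ "100 * exp 30"]) auto

end
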